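(* Let $X$ be a metric space and let $\{E_i\}_{i\in I}$ be a family of complex vector bundles of finite rank over $X$ with completed sum $q\colon\widehat E\to X$. Suppose there is an open cover $X=\bigcup_{\lambda\in\Lambda}U_\lambda$ such that each $U_\lambda$ trivializes all the $E_i$, $i\in I$, simultaneously, and on each $U_\lambda\cap U_\mu$ the transition functions of $E_i$ for $i\in I$ are equicontinuous. Suppose moreover: (1) the index set $I$ is a countable metric space; (2) $\sup\{\dim E_i\mid i\in I\}<\infty$. Then $q\colon\widehat E\to X$ is a Hilbert bundle with end.
   Context: Vector bundles carry Hermitian metrics and trivializations are unitary. For $x\in X$ let $\widehat E_x$ be the Hilbert space completion of $\bigoplus_{i\in I}(E_i)_x$; the completed sum is $\widehat E=\coprod_{x\in X}\widehat E_x$ with the map $q(\widehat E_x)=x$, topologized by the local trivializations over $U_\lambda$ induced from the simultaneous trivializations of the $E_i$. A family of maps $\{f_i\colon A\to A'\}_{i\in I}$ between metric spaces is equicontinuous if for any $\epsilon>0$ there is $\delta>0$ such that for each $i\in I$, $d(f_i(a_1),f_i(a_2))<\epsilon$ whenever $d(a_1,a_2)<\delta$. Unitary groups are metrized by the operator norm. A Hilbert bundle is a map that is locally trivial, with each fiber isometric to a Hilbert space $H$, and with transition functions continuous into the group of unitary operators on $H$ with the operator norm topology. Let $H$ have an orthonormal basis indexed by a countable metric space $J$. The propagation of a unitary $U=(U_{ij})_{i,j\in J}$ is $\sup\{d(i,j)\mid U_{ij}\ne0\}$; $\mathcal{U}_L(H)$ is the set of unitary operators of propagation $\le L$ with the operator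 norm topology, and $\mathcal{U}(H)=\bigcup_L\mathcal{U}_L(H)$ has the inductive limit topology ($C$ closed iff $C\cap\mathcal{U}_L(H)$ closed in $\mathcal{U}_L(H)$ for all $L$). A Hilbert bundle with fiber $H$ has an end if its transition functions are continuous maps into $\mathcal{U}(H)$. Here the basis of the fiber of $\widehat E$ is indexed by the pairs $(i,k)$ with $i\in I$, $1\le k\le\dim E_i$, with the metric $d((i,k),(j,l))$ equal to $d(i,j)$ if $i\ne j$, to $1$ if $i=j$ and $k\neq l$ and to $0$ if $(i,k)=(j,l)$, say after replacing the metric of $I$ by the coarsely equivalent metric that is at least $1$ between distinct points ($d(i,j)+1$). *)

theory Defs
  imports "HOL-Analysis.Analysis"
begin

section \<open>Hermitian spaces on a carrier set\<close>

(* Metric_space demands symmetry and nonnegativity of the distance also off the carrier. *)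
definition metric_on :: "'a set \<Rightarrow> ('a \<Rightarrow> 'a \<Rightarrow> real) \<Rightarrow> 'a metric" where
  "metric_on M d = metric (M, \<lambda>x y. if x \<in> M \<and> y \<in> M then d x y else 0)"

lemma metric_on:
  assumes "\<And>x y. x \<in> M \<Longrightarrow> y \<in> M \<Longrightarrow> 0 \<le> d x y"
    and "\<And>x y. x \<in> M \<Longrightarrow> y \<in> M \<Longrightarrow> d x y = d y x"
    and "\<And>x y. x \<in> M \<Longrightarrow> y \<in> M \<Longrightarrow> d x y = 0 \<longleftrightarrow> x = y"
    and "\<And>x y z. x \<in> M \<Longrightarrow> y \<in> M \<Longrightarrow> z \<in> M \<Longrightarrow> d x z \<le> d x y + d y z"
  shows "mspace (metric_on M d) = M"
    and "x \<in> M \<Longrightarrow> y \<in> M \<Longrightarrow> mdist (metric_on M d) x y = d x y"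
proof -
  let ?d = "\<lambda>x y. if x \<in> M \<and> y \<in> M then d x y else 0"
  interpret Metric_space M ?d
    by unfold_locales (use assms in auto)
  show "mspace (metric_on M d) = M"
    by (simp add: metric_on_def)
  show "x \<in> M \<Longrightarrow> y \<in> M \<Longrightarrow> mdist (metric_on M d) x y = d x y"
    by (simp add: metric_on_def)
qed

record 'v hermitian_space =
  vecs :: "'v set"
  vzero :: 'v
  vadd :: "'v \<Rightarrow> 'v \<Rightarrow> 'v"
  vscale :: "complex \<Rightarrow> 'v \<Rightarrow> 'v"
  herm :: "'v \<Rightarrow> 'v \<Rightarrow> complex"

definition vdiff :: "'v hermitian_space \<Rightarrow> 'v \<Rightarrow> 'v \<Rightarrow> 'v" where
  "vdiff V u v = vadd V u (vscale V (-1) v)"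

definition vnorm :: "'v hermitian_space \<Rightarrow> 'v \<Rightarrow> real" where
  "vnorm V v = sqrt (Re (herm V v v))"

definition vmetric :: "'v hermitian_space \<Rightarrow> 'v metric" where
  "vmetric V = metric_on (vecs V) (\<lambda>u v. vnorm V (vdiff V u v))"

locale inner_product_space =
  fixes V :: "'v hermitian_space"
  assumes zero_closed: "vzero V \<in> vecs V"
    and add_closed: "\<And>u v. u \<in> vecs V \<Longrightarrow> v \<in> vecs V \<Longrightarrow> vadd V u v \<in> vecs V"
    and scale_closed: "\<And>c v. v \<in> vecs V \<Longrightarrow> vscale V c v \<in> vecs V"
    and add_assoc: "\<And>u v w. u \<in> vecs V \<Longrightarrow> v \<in> vecs V \<Longrightarrow> w \<in> vecs V \<Longrightarrow>
          vadd V (vadd V u v) w = vadd V u (vadd V v w)"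
    and add_commute: "\<And>u v. u \<in> vecs V \<Longrightarrow> v \<in> vecs V \<Longrightarrow> vadd V u v = vadd V v u"
    and add_zero: "\<And>v. v \<in> vecs V \<Longrightarrow> vadd V v (vzero V) = v"
    and add_neg: "\<And>v. v \<in> vecs V \<Longrightarrow> vadd V v (vscale V (-1) v) = vzero V"
    and scale_one: "\<And>v. v \<in> vecs V \<Longrightarrow> vscale V 1 v = v"
    and scale_scale: "\<And>a b v. v \<in> vecs V \<Longrightarrow> vscale V a (vscale V b v) = vscale V (a * b) v"
    and scale_add_right: "\<And>a u v. u \<in> vecs V \<Longrightarrow> v \<in> vecs V \<Longrightarrow>
          vscale V a (vadd V u v) = vadd V (vscale V a u) (vscale V a v)"
    and scale_add_left: "\<And>a b v. v \<in> vecs V \<Longrightarrow>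
          vscale V (a + b) v = vadd V (vscale V a v) (vscale V b v)"
    and herm_sym: "\<And>u v. u \<in> vecs V \<Longrightarrow> v \<in> vecs V \<Longrightarrow> herm V v u = cnj (herm V u v)"
    and herm_add: "\<And>u v w. u \<in> vecs V \<Longrightarrow> v \<in> vecs V \<Longrightarrow> w \<in> vecs V \<Longrightarrow>
          herm V (vadd V u v) w = herm V u w + herm V v w"
    and herm_scale: "\<And>c u v. u \<in> vecs V \<Longrightarrow> v \<in> vecs V \<Longrightarrow>
          herm V (vscale V c u) v = c * herm V u v"
    and herm_pos: "\<And>v. v \<in> vecs V \<Longrightarrow> v \<noteq> vzero V \<Longrightarrow> 0 < Re (herm V v v)"
begin

lemma herm_add_right:
  assumes "u \<in> vecs V" "v \<in> vecs V" "w \<in> vecs V"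
  shows "herm V w (vadd V u v) = herm V w u + herm V w v"
  using herm_add[OF assms] herm_sym assms add_closed by (metis complex_cnj_add)

lemma herm_scale_right:
  assumes "u \<in> vecs V" "v \<in> vecs V"
  shows "herm V v (vscale V c u) = cnj c * herm V v u"
  using herm_scale[OF assms, of c] herm_sym assms scale_closed by (metis complex_cnj_mult)

lemma diff_closed: "u \<in> vecs V \<Longrightarrow> v \<in> vecs V \<Longrightarrow> vdiff V u v \<in> vecs V"
  by (simp add: vdiff_def add_closed scale_closed)

lemma herm_zero: 
  assumes "v \<in> vecs V"
  shows "herm V (vzero V) v = 0" "herm V v (vzero V) = 0"
proof -
  have "herm V (vzero V) v = herm V (vzero V) v + herm V (vzero V) v"
    using herm_add[OF zero_closed zero_closed assms] add_zero[OF zero_closed] by simp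
  then show "herm V (vzero V) v = 0" by simp
  then show "herm V v (vzero V) = 0"
    using herm_sym[OF zero_closed assms] by simp
qed

lemma herm_self_real: 
  assumes "v \<in> vecs V"
  shows "herm V v v = of_real (Re (herm V v v))"
  using herm_sym[OF assms assms] by (simp add: complex_eq_iff)

lemma herm_self_nonneg: "v \<in> vecs V \<Longrightarrow> 0 \<le> Re (herm V v v)"
  using herm_pos herm_zero by (cases "v = vzero V") (auto simp: less_imp_le)

lemma vnorm_nonneg: "v \<in> vecs V \<Longrightarrow> 0 \<le> vnorm V v"
  by (simp add: vnorm_def herm_self_nonneg)

lemma vnorm_power2: "v \<in> vecs V \<Longrightarrow> (vnorm V v)\<^sup>2 = Re (herm V v v)"
  by (simp add: vnorm_def herm_self_nonneg)

lemma vnorm_eq_0_iff: "v \<in> vecs V \<Longrightarrow> vnorm V v = 0 \<longleftrightarrow> v = vzero V"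
  using herm_pos herm_zero by (auto simp: vnorm_def) force

lemma vnorm_scale: 
  assumes "v \<in> vecs V"
  shows "vnorm V (vscale V c v) = cmod c * vnorm V v"
proof -
  have "herm V (vscale V c v) (vscale V c v) = (c * cnj c) * herm V v v"
    using assms by (simp add: herm_scale herm_scale_right scale_closed)
  also have "\<dots> = of_real ((cmod c)\<^sup>2 * Re (herm V v v))"
    by (metis complex_norm_square herm_self_real[OF assms] of_real_mult)
  finally show ?thesis
    by (simp add: vnorm_def real_sqrt_mult)
qed

lemma Cauchy_Schwarz:
  assumes u: "u \<in> vecs V" and v: "v \<in> vecs V"
  shows "cmod (herm V u v) \<le> vnorm V u * vnorm V v"
proof (cases "v = vzero V")
  case True
  then show ?thesis by (simp add: herm_zero u vnorm_nonneg zero_closed)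
next
  case False
  define b where "b = Re (herm V v v)"
  have b: "b > 0" using herm_pos[OF v False] by (simp add: b_def)
  have hv: "herm V v v = of_real b" using herm_self_real[OF v] by (simp add: b_def)
  define z where "z = herm V u v"
  define c where "c = - z / of_real b"
  have hvu: "herm V v u = cnj z" using herm_sym[OF u v] by (simp add: z_def)
  have cv: "vscale V c v \<in> vecs V" using v by (rule scale_closed)
  have "herm V (vadd V u (vscale V c v)) (vadd V u (vscale V c v))
      = herm V u u + cnj c * z + c * (cnj z + cnj c * of_real b)"
    using u v cv by (simp add: herm_add herm_add_right herm_scale herm_scale_right add_closed hv hvu
        z_def[symmetric] algebra_simps)
  also have "\<dots> = herm V u u - z * cnj z / of_real b"
    using b by (simp add: c_def field_simps)
  also have "z * cnj z = of_real ((cmod z)\<^sup>2)"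
    by (metis complex_norm_square)
  finally have "Re (herm V (vadd V u (vscale V c v)) (vadd V u (vscale V c v)))
      = Re (herm V u u) - (cmod z)\<^sup>2 / b"
    by (simp flip: of_real_divide of_real_power)
  then have "(cmod z)\<^sup>2 / b \<le> Re (herm V u u)"
    using herm_self_nonneg[OF add_closed[OF u cv]] by simp
  then have "(cmod z)\<^sup>2 \<le> Re (herm V u u) * Re (herm V v v)"
    using b by (simp add: field_simps b_def)
  then show ?thesis
    by (metis real_le_rsqrt real_sqrt_mult vnorm_def z_def)
qed

lemma vnorm_triangle:
  assumes u: "u \<in> vecs V" and v: "v \<in> vecs V"
  shows "vnorm V (vadd V u v) \<le> vnorm V u + vnorm V v"
proof (rule power2_le_imp_le)
  have "(vnorm V (vadd V u v))\<^sup>2 = (vnorm V u)\<^sup>2 + (vnorm V v)\<^sup>2 + 2 * Re (herm V u v)"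
    using u v by (simp add: vnorm_power2 add_closed herm_add herm_add_right herm_sym[OF u v])
  also have "\<dots> \<le> (vnorm V u)\<^sup>2 + (vnorm V v)\<^sup>2 + 2 * (vnorm V u * vnorm V v)"
    using Cauchy_Schwarz[OF u v] complex_Re_le_cmod[of "herm V u v"] by linarith
  finally show "(vnorm V (vadd V u v))\<^sup>2 \<le> (vnorm V u + vnorm V v)\<^sup>2"
    by (simp add: power2_sum)
  show "0 \<le> vnorm V u + vnorm V v" using u v by (simp add: vnorm_nonneg)
qed

lemma diff_add_diff:
  assumes u: "u \<in> vecs V" and v: "v \<in> vecs V" and w: "w \<in> vecs V"
  shows "vadd V (vdiff V u v) (vdiff V v w) = vdiff V u w"
proof -
  let ?v = "vscale V (-1) v" and ?w = "vscale V (-1) w"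
  have c: "?v \<in> vecs V" "?w \<in> vecs V" using v w by (auto intro: scale_closed)
  have "vadd V (vadd V u ?v) (vadd V v ?w) = vadd V u (vadd V (vadd V ?v v) ?w)"
    using u v c by (simp add: add_assoc add_closed)
  also have "vadd V ?v v = vzero V"
    using add_neg[OF v] add_commute[OF v c(1)] by simp
  also have "vadd V (vzero V) ?w = ?w"
    using add_zero[OF c(2)] add_commute[OF c(2) zero_closed] by simp
  finally show ?thesis by (simp add: vdiff_def)
qed

lemma diff_add_cancel:
  assumes u: "u \<in> vecs V" and v: "v \<in> vecs V"
  shows "vadd V (vdiff V u v) v = u"
proof -
  let ?v = "vscale V (-1) v"
  have c: "?v \<in> vecs V" using v by (auto intro: scale_closed)
  have "vadd V (vadd V u ?v) v = vadd V u (vadd V ?v v)"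
    using u v c by (simp add: add_assoc)
  also have "vadd V ?v v = vzero V"
    using add_neg[OF v] add_commute[OF v c(1)] by simp
  finally show ?thesis using add_zero[OF u] by (simp add: vdiff_def)
qed

lemma scale_minus_one_diff:
  assumes u: "u \<in> vecs V" and v: "v \<in> vecs V"
  shows "vscale V (-1) (vdiff V u v) = vdiff V v u"
  using assms by (simp add: vdiff_def scale_add_right scale_closed scale_scale scale_one
      add_commute)

lemma 
  shows mspace_vmetric: "mspace (vmetric V) = vecs V"
    and mdist_vmetric: "u \<in> vecs V \<Longrightarrow> v \<in> vecs V \<Longrightarrow> mdist (vmetric V) u v = vnorm V (vdiff V u v)"
proof -
  let ?d = "\<lambda>u v. vnorm V (vdiff V u v)"
  have 1: "0 \<le> ?d u v" if "u \<in> vecs V" "v \<in> vecs V" for u v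
    using that by (simp add: vnorm_nonneg diff_closed)
  have 2: "?d u v = ?d v u" if "u \<in> vecs V" "v \<in> vecs V" for u v
    using vnorm_scale[OF diff_closed[OF that], of "-1"] that by (simp add: scale_minus_one_diff)
  have 3: "?d u v = 0 \<longleftrightarrow> u = v" if "u \<in> vecs V" "v \<in> vecs V" for u v
  proof
    assume "?d u v = 0"
    then have "vdiff V u v = vzero V" using that by (simp add: vnorm_eq_0_iff diff_closed)
    then show "u = v"
      by (metis add_commute add_zero diff_add_cancel that zero_closed)
  next
    assume "u = v"
    then show "?d u v = 0"
      using that add_neg[of v] by (simp add: vnorm_eq_0_iff zero_closed vdiff_def)
  qed
  have 4: "?d u w \<le> ?d u v + ?d v w" if "u \<in> vecs V" "v \<in> vecs V" "w \<in> vecs V" for u v w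
    using vnorm_triangle[OF diff_closed[OF that(1,2)] diff_closed[OF that(2,3)]] that
    by (simp add: diff_add_diff)
  show "mspace (vmetric V) = vecs V"
    unfolding vmetric_def by (rule metric_on(1)[OF 1 2 3 4])
  show "u \<in> vecs V \<Longrightarrow> v \<in> vecs V \<Longrightarrow> mdist (vmetric V) u v = ?d u v"
    unfolding vmetric_def by (rule metric_on(2)[OF 1 2 3 4])
qed

end

definition hilbert_space :: "'v hermitian_space \<Rightarrow> bool" where
  "hilbert_space V \<longleftrightarrow> inner_product_space V \<and> mcomplete_of (vmetric V)"


section \<open>Hilbert sums and the spaces of square-summable families\<close>

definition hilbert_sum :: "'i set \<Rightarrow> ('i \<Rightarrow> 'v hermitian_space) \<Rightarrow> ('i \<Rightarrow> 'v) hermitian_space" where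
  "hilbert_sum I V =
     \<lparr>vecs = {v \<in> \<Pi>\<^sub>E i\<in>I. vecs (V i). (\<lambda>i. (vnorm (V i) (v i))\<^sup>2) summable_on I},
      vzero = (\<lambda>i\<in>I. vzero (V i)),
      vadd = (\<lambda>u v. \<lambda>i\<in>I. vadd (V i) (u i) (v i)),
      vscale = (\<lambda>c v. \<lambda>i\<in>I. vscale (V i) c (v i)),
      herm = (\<lambda>u v. \<Sum>\<^sub>\<infinity>i\<in>I. herm (V i) (u i) (v i))\<rparr>"

definition algebraic_sum :: "'i set \<Rightarrow> ('i \<Rightarrow> 'v hermitian_space) \<Rightarrow> ('i \<Rightarrow> 'v) set" where
  "algebraic_sum I V = {v \<in> \<Pi>\<^sub>E i\<in>I. vecs (V i). finite {i \<in> I. v i \<noteq> vzero (V i)}}"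

lemma hilbert_sum_simps:
  "vecs (hilbert_sum I V) = {v \<in> \<Pi>\<^sub>E i\<in>I. vecs (V i). (\<lambda>i. (vnorm (V i) (v i))\<^sup>2) summable_on I}"
  "vzero (hilbert_sum I V) = (\<lambda>i\<in>I. vzero (V i))"
  "vadd (hilbert_sum I V) u v = (\<lambda>i\<in>I. vadd (V i) (u i) (v i))"
  "vscale (hilbert_sum I V) c v = (\<lambda>i\<in>I. vscale (V i) c (v i))"
  "herm (hilbert_sum I V) u v = (\<Sum>\<^sub>\<infinity>i\<in>I. herm (V i) (u i) (v i))"
  by (simp_all add: hilbert_sum_def)

lemma vdiff_hilbert_sum: "i \<in> I \<Longrightarrow> vdiff (hilbert_sum I V) u v i = vdiff (V i) (u i) (v i)"
  by (simp add: vdiff_def hilbert_sum_simps)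

lemma (in inner_product_space) vnorm_add_power2:
  assumes "u \<in> vecs V" "v \<in> vecs V"
  shows "(vnorm V (vadd V u v))\<^sup>2 \<le> 2 * (vnorm V u)\<^sup>2 + 2 * (vnorm V v)\<^sup>2"
proof -
  have "(vnorm V (vadd V u v))\<^sup>2 \<le> (vnorm V u + vnorm V v)\<^sup>2"
    using assms by (intro power_mono vnorm_triangle vnorm_nonneg add_closed)
  also have "\<dots> \<le> 2 * (vnorm V u)\<^sup>2 + 2 * (vnorm V v)\<^sup>2"
    using sum_squares_bound[of "vnorm V u" "vnorm V v"] by (simp add: power2_sum)
  finally show ?thesis .
qed

context
  fixes I :: "'i set" and V :: "'i \<Rightarrow> 'v hermitian_space"
  assumes V: "\<And>i. i \<in> I \<Longrightarrow> inner_product_space (V i)"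
begin

lemmas
  fam_Cauchy_Schwarz = inner_product_space.Cauchy_Schwarz[OF V]
  and fam_add_assoc = inner_product_space.add_assoc[OF V]
  and fam_add_closed = inner_product_space.add_closed[OF V]
  and fam_add_commute = inner_product_space.add_commute[OF V]
  and fam_add_neg = inner_product_space.add_neg[OF V]
  and fam_add_zero = inner_product_space.add_zero[OF V]
  and fam_diff_add_cancel = inner_product_space.diff_add_cancel[OF V]
  and fam_diff_closed = inner_product_space.diff_closed[OF V]
  and fam_herm_add = inner_product_space.herm_add[OF V]
  and fam_herm_scale = inner_product_space.herm_scale[OF V]
  and fam_herm_sym = inner_product_space.herm_sym[OF V]
  and fam_mspace_vmetric = inner_product_space.mspace_vmetric[OF V]
  and fam_mdist_vmetric = inner_product_space.mdist_vmetric[OF V]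
  and fam_scale_minus_one_diff = inner_product_space.scale_minus_one_diff[OF V]
  and fam_scale_add_left = inner_product_space.scale_add_left[OF V]
  and fam_scale_add_right = inner_product_space.scale_add_right[OF V]
  and fam_scale_closed = inner_product_space.scale_closed[OF V]
  and fam_scale_one = inner_product_space.scale_one[OF V]
  and fam_scale_scale = inner_product_space.scale_scale[OF V]
  and fam_vnorm_add_power2 = inner_product_space.vnorm_add_power2[OF V]
  and fam_vnorm_eq_0_iff = inner_product_space.vnorm_eq_0_iff[OF V]
  and fam_vnorm_nonneg = inner_product_space.vnorm_nonneg[OF V]
  and fam_vnorm_power2 = inner_product_space.vnorm_power2[OF V]
  and fam_vnorm_scale = inner_product_space.vnorm_scale[OF V]
  and fam_zero_closed = inner_product_space.zero_closed[OF V]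

lemma hilbert_sum_memD:
  assumes "v \<in> vecs (hilbert_sum I V)"
  shows "i \<in> I \<Longrightarrow> v i \<in> vecs (V i)" "v \<in> extensional I"
    "(\<lambda>i. (vnorm (V i) (v i))\<^sup>2) summable_on I"
  using assms by (auto simp: hilbert_sum_simps PiE_def)

lemma hilbert_sum_memI:
  assumes "\<And>i. i \<in> I \<Longrightarrow> v i \<in> vecs (V i)" "v \<in> extensional I"
    and "g summable_on I" "\<And>i. i \<in> I \<Longrightarrow> (vnorm (V i) (v i))\<^sup>2 \<le> g i"
  shows "v \<in> vecs (hilbert_sum I V)"
proof -
  have "(\<lambda>i. (vnorm (V i) (v i))\<^sup>2) summable_on I"
    by (rule summable_on_comparison_test[OF assms(3)]) (use assms in auto)
  then show ?thesis using assms by (auto simp: hilbert_sum_simps PiE_def)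
qed

lemma hilbert_sum_herm_summable:
  assumes u: "u \<in> vecs (hilbert_sum I V)" and v: "v \<in> vecs (hilbert_sum I V)"
  shows "(\<lambda>i. herm (V i) (u i) (v i)) summable_on I"
proof -
  have "(\<lambda>i. (vnorm (V i) (u i))\<^sup>2 + (vnorm (V i) (v i))\<^sup>2) summable_on I"
    by (intro summable_on_add hilbert_sum_memD u v)
  then have "(\<lambda>i. norm (herm (V i) (u i) (v i))) summable_on I"
  proof (rule summable_on_comparison_test)
    fix i assume i: "i \<in> I"
    have "norm (herm (V i) (u i) (v i)) \<le> vnorm (V i) (u i) * vnorm (V i) (v i)"
      using i u v by (intro fam_Cauchy_Schwarz hilbert_sum_memD)
    also have "\<dots> \<le> (vnorm (V i) (u i))\<^sup>2 + (vnorm (V i) (v i))\<^sup>2"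
      using sum_squares_bound[of "vnorm (V i) (u i)" "vnorm (V i) (v i)"]
        mult_nonneg_nonneg[OF fam_vnorm_nonneg[OF i hilbert_sum_memD(1)[OF u i]]
          fam_vnorm_nonneg[OF i hilbert_sum_memD(1)[OF v i]]]
      by linarith
    finally show "norm (herm (V i) (u i) (v i)) \<le> (vnorm (V i) (u i))\<^sup>2 + (vnorm (V i) (v i))\<^sup>2" .
  qed auto
  then show ?thesis by (rule abs_summable_summable)
qed

lemma hilbert_sum_add_mem:
  assumes u: "u \<in> vecs (hilbert_sum I V)" and v: "v \<in> vecs (hilbert_sum I V)"
  shows "vadd (hilbert_sum I V) u v \<in> vecs (hilbert_sum I V)"
proof (rule hilbert_sum_memI)
  show "(\<lambda>i. 2 * (vnorm (V i) (u i))\<^sup>2 + 2 * (vnorm (V i) (v i))\<^sup>2) summable_on I"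
    by (intro summable_on_add summable_on_cmult_right hilbert_sum_memD u v)
qed (use u v in \<open>auto simp: hilbert_sum_simps(3) hilbert_sum_memD fam_add_closed fam_vnorm_add_power2\<close>)

lemma hilbert_sum_scale_mem:
  assumes v: "v \<in> vecs (hilbert_sum I V)"
  shows "vscale (hilbert_sum I V) c v \<in> vecs (hilbert_sum I V)"
proof (rule hilbert_sum_memI)
  show "(\<lambda>i. (cmod c)\<^sup>2 * (vnorm (V i) (v i))\<^sup>2) summable_on I"
    by (intro summable_on_cmult_right hilbert_sum_memD v)
qed (use v in \<open>auto simp: hilbert_sum_simps(4) hilbert_sum_memD fam_scale_closed fam_vnorm_scale
  power_mult_distrib\<close>)

lemma hilbert_sum_herm_self:
  assumes v: "v \<in> vecs (hilbert_sum I V)"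
  shows "Re (herm (hilbert_sum I V) v v) = (\<Sum>\<^sub>\<infinity>i\<in>I. (vnorm (V i) (v i))\<^sup>2)"
proof -
  have "Re (herm (hilbert_sum I V) v v) = (\<Sum>\<^sub>\<infinity>i\<in>I. Re (herm (V i) (v i) (v i)))"
    by (simp only: hilbert_sum_simps infsum_Re[OF hilbert_sum_herm_summable[OF v v]])
  also have "\<dots> = (\<Sum>\<^sub>\<infinity>i\<in>I. (vnorm (V i) (v i))\<^sup>2)"
    by (intro infsum_cong) (simp add: fam_vnorm_power2 hilbert_sum_memD v)
  finally show ?thesis .
qed

lemma inner_product_space_hilbert_sum: "inner_product_space (hilbert_sum I V)"
proof
  let ?S = "hilbert_sum I V"
  note ext = extensionalityI[where A = I]
  show "vzero ?S \<in> vecs ?S"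
    by (rule hilbert_sum_memI[where g = "\<lambda>_. 0"])
      (auto simp: hilbert_sum_simps(2) fam_zero_closed fam_vnorm_eq_0_iff)
  show "vadd ?S u v \<in> vecs ?S" if "u \<in> vecs ?S" "v \<in> vecs ?S" for u v
    using that by (rule hilbert_sum_add_mem)
  show "vscale ?S c v \<in> vecs ?S" if "v \<in> vecs ?S" for c v
    using that by (rule hilbert_sum_scale_mem)
  show "vadd ?S (vadd ?S u v) w = vadd ?S u (vadd ?S v w)"
    if "u \<in> vecs ?S" "v \<in> vecs ?S" "w \<in> vecs ?S" for u v w
    by (rule ext) (use that in \<open>auto simp: hilbert_sum_simps(3) fam_add_assoc hilbert_sum_memD(1)\<close>)
  show "vadd ?S u v = vadd ?S v u" if "u \<in> vecs ?S" "v \<in> vecs ?S" for u v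
    by (rule ext) (use that in \<open>auto simp: hilbert_sum_simps(3) fam_add_commute hilbert_sum_memD(1)\<close>)
  show "vadd ?S v (vzero ?S) = v" if "v \<in> vecs ?S" for v
    by (rule ext) (use that in \<open>auto simp: hilbert_sum_simps(2,3) fam_add_zero hilbert_sum_memD(1,2)\<close>)
  show "vadd ?S v (vscale ?S (-1) v) = vzero ?S" if "v \<in> vecs ?S" for v
    by (rule ext) (use that in \<open>auto simp: hilbert_sum_simps(2,3,4) fam_add_neg hilbert_sum_memD(1,2)\<close>)
  show "vscale ?S 1 v = v" if "v \<in> vecs ?S" for v
    by (rule ext) (use that in \<open>auto simp: hilbert_sum_simps(4) fam_scale_one hilbert_sum_memD(1,2)\<close>)
  show "vscale ?S a (vscale ?S b v) = vscale ?S (a * b) v" if "v \<in> vecs ?S" for a b v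
    by (rule ext) (use that in \<open>auto simp: hilbert_sum_simps(4) fam_scale_scale hilbert_sum_memD(1,2)\<close>)
  show "vscale ?S a (vadd ?S u v) = vadd ?S (vscale ?S a u) (vscale ?S a v)"
    if "u \<in> vecs ?S" "v \<in> vecs ?S" for a u v
    by (rule ext) (use that in \<open>auto simp: hilbert_sum_simps(3,4) fam_scale_add_right hilbert_sum_memD(1)\<close>)
  show "vscale ?S (a + b) v = vadd ?S (vscale ?S a v) (vscale ?S b v)" if "v \<in> vecs ?S" for a b v
    by (rule ext) (use that in \<open>auto simp: hilbert_sum_simps(3,4) fam_scale_add_left hilbert_sum_memD(1)\<close>)
  show "herm ?S v u = cnj (herm ?S u v)" if "u \<in> vecs ?S" "v \<in> vecs ?S" for u v
  proof -
    have "herm ?S v u = (\<Sum>\<^sub>\<infinity>i\<in>I. cnj (herm (V i) (u i) (v i)))"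
      unfolding hilbert_sum_simps
      by (intro infsum_cong) (use that in \<open>metis fam_herm_sym hilbert_sum_memD(1)\<close>)
    then show ?thesis by (simp add: hilbert_sum_simps)
  qed
  show "herm ?S (vadd ?S u v) w = herm ?S u w + herm ?S v w"
    if "u \<in> vecs ?S" "v \<in> vecs ?S" "w \<in> vecs ?S" for u v w
  proof -
    have "herm ?S (vadd ?S u v) w = (\<Sum>\<^sub>\<infinity>i\<in>I. herm (V i) (u i) (w i) + herm (V i) (v i) (w i))"
      unfolding hilbert_sum_simps
      by (intro infsum_cong) (use that in \<open>simp add: fam_herm_add hilbert_sum_memD(1)\<close>)
    then show ?thesis
      using that by (simp add: infsum_add hilbert_sum_herm_summable hilbert_sum_simps(5))
  qed
  show "herm ?S (vscale ?S c u) v = c * herm ?S u v"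
    if "u \<in> vecs ?S" "v \<in> vecs ?S" for c u v
  proof -
    have "herm ?S (vscale ?S c u) v = (\<Sum>\<^sub>\<infinity>i\<in>I. c * herm (V i) (u i) (v i))"
      unfolding hilbert_sum_simps
      by (intro infsum_cong) (use that in \<open>simp add: fam_herm_scale hilbert_sum_memD(1)\<close>)
    then show ?thesis by (simp add: infsum_cmult_right' hilbert_sum_simps(5))
  qed
  show "0 < Re (herm ?S v v)" if v: "v \<in> vecs ?S" and nz: "v \<noteq> vzero ?S" for v
  proof (rule ccontr)
    assume "\<not> 0 < Re (herm ?S v v)"
    then have "(\<Sum>\<^sub>\<infinity>i\<in>I. (vnorm (V i) (v i))\<^sup>2) \<le> 0"
      by (simp add: hilbert_sum_herm_self v)
    then have "(vnorm (V i) (v i))\<^sup>2 = 0" if "i \<in> I" for i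
      using nonneg_infsum_le_0D[of "\<lambda>i. (vnorm (V i) (v i))\<^sup>2" I i] hilbert_sum_memD(3)[OF v] that
      by simp
    then have "v i = vzero (V i)" if "i \<in> I" for i
      using that by (simp add: fam_vnorm_eq_0_iff hilbert_sum_memD(1)[OF v])
    then have "v = vzero ?S"
      by (intro ext) (auto simp: hilbert_sum_simps(2) hilbert_sum_memD(2)[OF v])
    with nz show False ..
  qed
qed

lemma vnorm_hilbert_sum:
  assumes "v \<in> vecs (hilbert_sum I V)"
  shows "(vnorm (hilbert_sum I V) v)\<^sup>2 = (\<Sum>\<^sub>\<infinity>i\<in>I. (vnorm (V i) (v i))\<^sup>2)"
  using assms
  by (simp add: inner_product_space.vnorm_power2[OF inner_product_space_hilbert_sum]
      hilbert_sum_herm_self)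

interpretation S: inner_product_space "hilbert_sum I V"
  by (rule inner_product_space_hilbert_sum)

text \<open>By \<open>closure_algebraic_sum\<close> and \<open>hilbert_space_hilbert_sum\<close>, the Hilbert sum of a family
  of Hilbert spaces is the completion of their algebraic direct sum.\<close>

lemma closure_algebraic_sum:
  "mtopology_of (vmetric (hilbert_sum I V)) closure_of algebraic_sum I V = vecs (hilbert_sum I V)"
proof -
  let ?S = "hilbert_sum I V"
  interpret M: Metric_space "mspace (vmetric ?S)" "mdist (vmetric ?S)" by simp
  have "\<exists>y\<in>algebraic_sum I V. y \<in> M.mball v r" if v: "v \<in> vecs ?S" and r: "r > 0" for v r
  proof -
    define f where "f = (\<lambda>i. (vnorm (V i) (v i))\<^sup>2)"
    have f: "f summable_on I" using hilbert_sum_memD(3)[OF v] by (simp add: f_def)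
    then have "(f has_sum infsum f I) I" by (rule has_sum_infsum)
    then have "\<forall>\<^sub>F F in finite_subsets_at_top I. dist (sum f F) (infsum f I) < r\<^sup>2"
      unfolding has_sum_def by (rule tendstoD) (use r in simp)
    then obtain F where F: "finite F" "F \<subseteq> I" "dist (sum f F) (infsum f I) < r\<^sup>2"
      by (auto simp: eventually_finite_subsets_at_top)
    define y where "y = (\<lambda>i\<in>I. if i \<in> F then v i else vzero (V i))"
    have y: "y \<in> algebraic_sum I V"
      using F hilbert_sum_memD(1)[OF v]
      by (auto simp: algebraic_sum_def y_def fam_zero_closed intro: finite_subset[OF _ F(1)])
    have yS: "y \<in> vecs ?S"
    proof (rule hilbert_sum_memI[OF _ _ f])
      show "(vnorm (V i) (y i))\<^sup>2 \<le> f i" if "i \<in> I" for i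
        using fam_vnorm_eq_0_iff[OF that fam_zero_closed[OF that]] that by (auto simp: y_def f_def)
    qed (auto simp: y_def fam_zero_closed hilbert_sum_memD(1)[OF v])
    have *: "(vnorm (V i) (vdiff ?S v y i))\<^sup>2 = (if i \<in> F then 0 else f i)" if i: "i \<in> I" for i
    proof (cases "i \<in> F")
      case True
      then show ?thesis
        using i fam_add_neg[OF i, of "v i"] fam_vnorm_eq_0_iff[OF i fam_zero_closed[OF i]]
          hilbert_sum_memD(1)[OF v i]
        by (simp add: vdiff_hilbert_sum y_def vdiff_def[of "V i"])
    next
      case False
      then show ?thesis
        using i fam_diff_add_cancel[OF i hilbert_sum_memD(1)[OF v i] fam_zero_closed[OF i]]
          fam_add_zero[OF i fam_diff_closed[OF i hilbert_sum_memD(1)[OF v i] fam_zero_closed[OF i]]]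
        by (simp add: vdiff_hilbert_sum y_def f_def)
    qed
    have "(vnorm ?S (vdiff ?S v y))\<^sup>2 = (\<Sum>\<^sub>\<infinity>i\<in>I. if i \<in> F then 0 else f i)"
      using v yS by (simp add: vnorm_hilbert_sum S.diff_closed * cong: infsum_cong)
    also have "\<dots> = infsum f (I - F)"
      by (rule infsum_cong_neutral) auto
    also have "\<dots> = infsum f I - sum f F"
      using f F by (subst infsum_Diff) auto
    also have "\<dots> < r\<^sup>2" using F(3) by (simp add: dist_real_def)
    finally have "vnorm ?S (vdiff ?S v y) < r"
      using r by (meson less_imp_le power_less_imp_less_base)
    then have "y \<in> M.mball v r"
      unfolding M.in_mball unfolding S.mspace_vmetric using v yS by (simp add: S.mdist_vmetric)
    with y show ?thesis by blast
  qed
  then have "{x \<in> vecs ?S. \<forall>r>0. \<exists>y\<in>algebraic_sum I V. y \<in> M.mball x r} = vecs ?S"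
    by blast
  then show ?thesis
    unfolding mtopology_of_def M.metric_closure_of by (simp only: S.mspace_vmetric)
qed

lemma hilbert_sum_finite_le:
  assumes v: "v \<in> vecs (hilbert_sum I V)" and F: "finite F" "F \<subseteq> I"
  shows "(\<Sum>i\<in>F. (vnorm (V i) (v i))\<^sup>2) \<le> (vnorm (hilbert_sum I V) v)\<^sup>2"
  unfolding vnorm_hilbert_sum[OF v]
  by (rule finite_sum_le_infsum) (use v F hilbert_sum_memD(3) in auto)

lemma hilbert_space_hilbert_sum:
  assumes complete: "\<And>i. i \<in> I \<Longrightarrow> hilbert_space (V i)"
  shows "hilbert_space (hilbert_sum I V)"
proof -
  let ?S = "hilbert_sum I V"
  interpret M: Metric_space "mspace (vmetric ?S)" "mdist (vmetric ?S)" by simp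
  have "\<exists>w. limitin M.mtopology s w sequentially" if s: "M.MCauchy s" for s
  proof -
    have sS: "s n \<in> vecs ?S" for n
      using s unfolding M.MCauchy_def unfolding S.mspace_vmetric by auto
    have si: "s n i \<in> vecs (V i)" if "i \<in> I" for n i
      using hilbert_sum_memD(1)[OF sS that] .
    have cauchy: "\<exists>N. \<forall>n\<ge>N. \<forall>m\<ge>N. vnorm ?S (vdiff ?S (s n) (s m)) < e" if "e > 0" for e
      using s that sS by (simp add: M.MCauchy_def S.mdist_vmetric)
    have fin: "(\<Sum>i\<in>F. (vnorm (V i) (vdiff (V i) (s n i) (s m i)))\<^sup>2)
        \<le> (vnorm ?S (vdiff ?S (s n) (s m)))\<^sup>2" if F: "finite F" "F \<subseteq> I" for F n m
    proof -
      have "(\<Sum>i\<in>F. (vnorm (V i) (vdiff (V i) (s n i) (s m i)))\<^sup>2)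
          = (\<Sum>i\<in>F. (vnorm (V i) (vdiff ?S (s n) (s m) i))\<^sup>2)"
        by (intro sum.cong) (use F in \<open>auto simp: vdiff_hilbert_sum\<close>)
      then show ?thesis
        using hilbert_sum_finite_le[OF S.diff_closed[OF sS sS] F] by simp
    qed
    have "\<exists>w. w \<in> vecs (V i) \<and> (\<lambda>n. vnorm (V i) (vdiff (V i) (s n i) w)) \<longlonglongrightarrow> 0"
      if i: "i \<in> I" for i
    proof -
      interpret Mi: Metric_space "mspace (vmetric (V i))" "mdist (vmetric (V i))" by simp
      have le: "vnorm (V i) (vdiff (V i) (s n i) (s m i)) \<le> vnorm ?S (vdiff ?S (s n) (s m))" for n m
        by (rule power2_le_imp_le)
          (use fin[of "{i}" n m] i in \<open>simp_all add: S.vnorm_nonneg S.diff_closed sS\<close>)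
      have "Mi.MCauchy (\<lambda>n. s n i)"
        unfolding Mi.MCauchy_def
      proof (intro conjI allI impI)
        show "range (\<lambda>n. s n i) \<subseteq> mspace (vmetric (V i))"
          using si[OF i] by (auto simp: fam_mspace_vmetric[OF i])
        fix e :: real assume "e > 0"
        then obtain N where "\<forall>n\<ge>N. \<forall>m\<ge>N. vnorm ?S (vdiff ?S (s n) (s m)) < e"
          using cauchy by blast
        then show "\<exists>N. \<forall>n m. N \<le> n \<longrightarrow> N \<le> m \<longrightarrow> mdist (vmetric (V i)) (s n i) (s m i) < e"
          using le by (intro exI[of _ N]) (simp add: fam_mdist_vmetric i si, meson le_less_trans)
      qed
      then obtain w where w: "limitin Mi.mtopology (\<lambda>n. s n i) w sequentially"
        using complete[OF i] by (auto simp: hilbert_space_def mcomplete_of_def Mi.mcomplete_def)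
      then have "w \<in> vecs (V i)" and "(\<lambda>n. mdist (vmetric (V i)) (s n i) w) \<longlonglongrightarrow> 0"
        unfolding Mi.limitin_metric_dist_null unfolding fam_mspace_vmetric[OF i] by auto
      then show ?thesis
        by (auto simp: fam_mdist_vmetric i si)
    qed
    then obtain w where w: "w i \<in> vecs (V i)"
      and lim: "(\<lambda>n. vnorm (V i) (vdiff (V i) (s n i) (w i))) \<longlonglongrightarrow> 0" if "i \<in> I" for i
      by metis
    have lim2: "(\<lambda>m. vnorm (V i) (vdiff (V i) (s n i) (s m i)))
        \<longlonglongrightarrow> vnorm (V i) (vdiff (V i) (s n i) (w i))" if i: "i \<in> I" for n i
    proof -
      let ?d = "mdist (vmetric (V i))"
      have tri: "\<bar>?d (s n i) (s m i) - ?d (s n i) (w i)\<bar> \<le> ?d (s m i) (w i)" for m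
        using mdist_triangle[of "s n i" "vmetric (V i)" "s m i" "w i"]
          mdist_triangle[of "s n i" "vmetric (V i)" "w i" "s m i"]
          mdist_commute[of "vmetric (V i)" "s m i" "w i"]
        by (auto simp: fam_mspace_vmetric i si w)
      have "(\<lambda>m. ?d (s m i) (w i)) \<longlonglongrightarrow> 0"
        using lim[OF i] by (simp add: fam_mdist_vmetric i si w)
      then have "(\<lambda>m. ?d (s n i) (s m i) - ?d (s n i) (w i)) \<longlonglongrightarrow> 0"
        by (rule Lim_null_comparison[rotated]) (use tri in simp)
      then have "(\<lambda>m. ?d (s n i) (s m i)) \<longlonglongrightarrow> ?d (s n i) (w i)"
        by (rule LIM_zero_cancel)
      then show ?thesis
        by (simp add: fam_mdist_vmetric i si w)
    qed
    let ?u = "\<lambda>n. \<lambda>i\<in>I. vdiff (V i) (s n i) (w i)"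
    let ?w = "\<lambda>i\<in>I. w i"
    have bound: "?u n \<in> vecs ?S \<and> vnorm ?S (?u n) \<le> e"
      if e: "e > 0" and N: "\<forall>n\<ge>N. \<forall>m\<ge>N. vnorm ?S (vdiff ?S (s n) (s m)) < e" and n: "n \<ge> N"
      for e N n
    proof -
      have F: "(\<Sum>i\<in>F. (vnorm (V i) (?u n i))\<^sup>2) \<le> e\<^sup>2" if F: "finite F" "F \<subseteq> I" for F
      proof (rule LIMSEQ_le_const2)
        show "(\<lambda>m. \<Sum>i\<in>F. (vnorm (V i) (vdiff (V i) (s n i) (s m i)))\<^sup>2)
            \<longlonglongrightarrow> (\<Sum>i\<in>F. (vnorm (V i) (?u n i))\<^sup>2)"
        proof (rule tendsto_sum)
          fix i assume "i \<in> F"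
          then have "i \<in> I" using F by blast
          then show "(\<lambda>m. (vnorm (V i) (vdiff (V i) (s n i) (s m i)))\<^sup>2)
              \<longlonglongrightarrow> (vnorm (V i) (?u n i))\<^sup>2"
            using tendsto_power[OF lim2, of i n 2] by simp
        qed
        have "(\<Sum>i\<in>F. (vnorm (V i) (vdiff (V i) (s n i) (s m i)))\<^sup>2) \<le> e\<^sup>2" if "m \<ge> N" for m
        proof -
          have "(vnorm ?S (vdiff ?S (s n) (s m)))\<^sup>2 \<le> e\<^sup>2"
            using N n that by (intro power_mono S.vnorm_nonneg S.diff_closed sS) (auto simp: less_imp_le)
          then show ?thesis using fin[OF F, of n m] by linarith
        qed
        then show "\<exists>N. \<forall>m\<ge>N. (\<Sum>i\<in>F. (vnorm (V i) (vdiff (V i) (s n i) (s m i)))\<^sup>2) \<le> e\<^sup>2"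
          by blast
      qed
      have sm: "(\<lambda>i. (vnorm (V i) (?u n i))\<^sup>2) summable_on I"
        by (rule nonneg_bdd_above_summable_on) (use F in \<open>auto intro!: bdd_aboveI2[where M = "e\<^sup>2"]\<close>)
      have u: "?u n \<in> vecs ?S"
        by (rule hilbert_sum_memI[OF _ _ sm]) (auto simp: fam_diff_closed si w)
      have "(vnorm ?S (?u n))\<^sup>2 \<le> e\<^sup>2"
        unfolding vnorm_hilbert_sum[OF u] using sm F by (rule infsum_le_finite_sums)
      then have "vnorm ?S (?u n) \<le> e"
        by (rule power2_le_imp_le) (use e in simp)
      with u show ?thesis by blast
    qed
    have wS: "?w \<in> vecs ?S"
    proof -
      obtain N where "\<forall>n\<ge>N. \<forall>m\<ge>N. vnorm ?S (vdiff ?S (s n) (s m)) < 1"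
        using cauchy[of 1] by auto
      then have "?u N \<in> vecs ?S" using bound[of 1 N N] by simp
      then have "vdiff ?S (s N) (?u N) \<in> vecs ?S" using sS by (intro S.diff_closed)
      moreover have "vdiff ?S (s N) (?u N) = ?w"
      proof (rule extensionalityI[where A = I])
        show "vdiff ?S (s N) (?u N) \<in> extensional I" "?w \<in> extensional I"
          by (auto simp: vdiff_def hilbert_sum_simps)
        fix i assume i: "i \<in> I"
        have "vadd (V i) (s N i) (vscale (V i) (-1) (vdiff (V i) (s N i) (w i)))
            = vadd (V i) (s N i) (vdiff (V i) (w i) (s N i))"
          using i by (simp add: fam_scale_minus_one_diff si w)
        also have "\<dots> = w i"
          using i by (simp add: fam_add_commute[of i "s N i"] fam_diff_closed fam_diff_add_cancel si w)
        finally show "vdiff ?S (s N) (?u N) i = ?w i"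
          using i by (simp add: vdiff_hilbert_sum vdiff_def[of _ "s N i" "vdiff _ _ _"])
      qed
      ultimately show ?thesis by simp
    qed
    have eq: "vdiff ?S (s n) ?w = ?u n" for n
      by (rule extensionalityI[where A = I]) (auto simp: vdiff_def hilbert_sum_simps)
    have "\<exists>N. \<forall>n\<ge>N. mdist (vmetric ?S) (s n) ?w < e" if e: "e > 0" for e
    proof -
      obtain N where "\<forall>n\<ge>N. \<forall>m\<ge>N. vnorm ?S (vdiff ?S (s n) (s m)) < e / 2"
        using cauchy[of "e / 2"] e by auto
      then have "vnorm ?S (?u n) \<le> e / 2" if "n \<ge> N" for n
        using bound[of "e / 2" N n] e that by simp
      then show ?thesis
        using e by (intro exI[of _ N]) (force simp: S.mdist_vmetric sS wS eq)
    qed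
    then have "limitin M.mtopology s ?w sequentially"
      unfolding M.limit_metric_sequentially unfolding S.mspace_vmetric using sS wS by auto
    then show ?thesis by blast
  qed
  then show ?thesis
    by (auto simp: hilbert_space_def inner_product_space_hilbert_sum mcomplete_of_def M.mcomplete_def)
qed

end

definition complex_line :: "complex hermitian_space" where
  "complex_line = \<lparr>vecs = UNIV, vzero = 0, vadd = (+), vscale = (*), herm = (\<lambda>a b. a * cnj b)\<rparr>"

definition ell2 :: "'j set \<Rightarrow> ('j \<Rightarrow> complex) hermitian_space" where
  "ell2 J = hilbert_sum J (\<lambda>_. complex_line)"

definition std_basis :: "'j set \<Rightarrow> 'j \<Rightarrow> 'j \<Rightarrow> complex" where
  "std_basis J j = (\<lambda>i\<in>J. if i = j then 1 else 0)"

abbreviation unitary_space :: "nat \<Rightarrow> (nat \<Rightarrow> complex) hermitian_space" where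
  "unitary_space n \<equiv> ell2 {1..n}"

lemma hilbert_space_complex_line: "hilbert_space complex_line"
proof -
  interpret inner_product_space complex_line
    by unfold_locales
      (auto simp: complex_line_def algebra_simps complex_neq_0 simp flip: power2_eq_square)
  have "vmetric complex_line = euclidean_metric"
    unfolding vmetric_def metric_on_def euclidean_metric_def
    by (auto simp: complex_line_def vdiff_def vnorm_def fun_eq_iff dist_norm cmod_def power2_eq_square
        algebra_simps
        intro!: arg_cong[where f = metric])
  then show ?thesis
    using inner_product_space_axioms complete_UNIV
    by (simp add: hilbert_space_def mcomplete_of_def)
qed

lemma hilbert_space_ell2: "hilbert_space (ell2 J)"
  unfolding ell2_def
  by (rule hilbert_space_hilbert_sum)
    (use hilbert_space_complex_line in \<open>auto simp: hilbert_space_def\<close>)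


section \<open>Unitary operators and propagation\<close>

definition unitary_map :: "'v hermitian_space \<Rightarrow> 'w hermitian_space \<Rightarrow> ('v \<Rightarrow> 'w) \<Rightarrow> bool" where
  "unitary_map V W f \<longleftrightarrow>
     bij_betw f (vecs V) (vecs W) \<and>
     (\<forall>u\<in>vecs V. \<forall>v\<in>vecs V. f (vadd V u v) = vadd W (f u) (f v)) \<and>
     (\<forall>c. \<forall>v\<in>vecs V. f (vscale V c v) = vscale W c (f v)) \<and>
     (\<forall>u\<in>vecs V. \<forall>v\<in>vecs V. herm W (f u) (f v) = herm V u v)"

definition unitaries :: "'h hermitian_space \<Rightarrow> ('h \<Rightarrow> 'h) set" where
  "unitaries H = {f \<in> extensional (vecs H). unitary_map H H f}"

(* The operator norm of f - g. *)
definition op_dist :: "'h hermitian_space \<Rightarrow> ('h \<Rightarrow> 'h) \<Rightarrow> ('h \<Rightarrow> 'h) \<Rightarrow> real" where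
  "op_dist H f g = (SUP v\<in>{v \<in> vecs H. vnorm H v \<le> 1}. vnorm H (vdiff H (f v) (g v)))"

definition unitary_metric :: "'h hermitian_space \<Rightarrow> ('h \<Rightarrow> 'h) metric" where
  "unitary_metric H = metric_on (unitaries H) (op_dist H)"

definition orthonormal_basis :: "'h hermitian_space \<Rightarrow> 'j set \<Rightarrow> ('j \<Rightarrow> 'h) \<Rightarrow> bool" where
  "orthonormal_basis H J b \<longleftrightarrow>
     (\<forall>j\<in>J. b j \<in> vecs H) \<and>
     (\<forall>i\<in>J. \<forall>j\<in>J. herm H (b i) (b j) = (if i = j then 1 else 0)) \<and>
     (\<forall>v\<in>vecs H. (\<forall>j\<in>J. herm H v (b j) = 0) \<longrightarrow> v = vzero H)"

(* The matrix entry with row i and column j is the inner product of f (b j) with b i. *)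
definition propagation ::
    "'h hermitian_space \<Rightarrow> 'j metric \<Rightarrow> ('j \<Rightarrow> 'h) \<Rightarrow> ('h \<Rightarrow> 'h) \<Rightarrow> ereal" where
  "propagation H J b f =
     (SUP (i, j)\<in>{(i, j). i \<in> mspace J \<and> j \<in> mspace J \<and> herm H (f (b j)) (b i) \<noteq> 0}.
        ereal (mdist J i j))"

definition unitaries_prop_le ::
    "'h hermitian_space \<Rightarrow> 'j metric \<Rightarrow> ('j \<Rightarrow> 'h) \<Rightarrow> real \<Rightarrow> ('h \<Rightarrow> 'h) set" where
  "unitaries_prop_le H J b L = {f \<in> unitaries H. propagation H J b f \<le> ereal L}"

definition end_unitaries ::
    "'h hermitian_space \<Rightarrow> 'j metric \<Rightarrow> ('j \<Rightarrow> 'h) \<Rightarrow> ('h \<Rightarrow> 'h) set" where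
  "end_unitaries H J b = (\<Union>L. unitaries_prop_le H J b L)"

definition end_topology ::
    "'h hermitian_space \<Rightarrow> 'j metric \<Rightarrow> ('j \<Rightarrow> 'h) \<Rightarrow> ('h \<Rightarrow> 'h) topology" where
  "end_topology H J b = topology (\<lambda>S. S \<subseteq> end_unitaries H J b \<and>
     (\<forall>L. closedin (mtopology_of (submetric (unitary_metric H) (unitaries_prop_le H J b L)))
            ((end_unitaries H J b - S) \<inter> unitaries_prop_le H J b L)))"

context inner_product_space
begin

lemma unitary_vnorm: "f \<in> unitaries V \<Longrightarrow> v \<in> vecs V \<Longrightarrow> vnorm V (f v) = vnorm V v"
  by (simp add: unitaries_def unitary_map_def vnorm_def)

lemma unitary_closed: "f \<in> unitaries V \<Longrightarrow> v \<in> vecs V \<Longrightarrow> f v \<in> vecs V"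
  by (auto simp: unitaries_def unitary_map_def bij_betw_def)

lemma op_dist_bdd:
  assumes f: "f \<in> unitaries V" and g: "g \<in> unitaries V"
  shows "bdd_above ((\<lambda>v. vnorm V (vdiff V (f v) (g v))) ` {v \<in> vecs V. vnorm V v \<le> 1})"
proof (rule bdd_aboveI2)
  fix v assume v: "v \<in> {v \<in> vecs V. vnorm V v \<le> 1}"
  have "vnorm V (vdiff V (f v) (g v)) \<le> vnorm V (f v) + vnorm V (vscale V (-1) (g v))"
    unfolding vdiff_def
    using v unitary_closed[OF f] unitary_closed[OF g] by (intro vnorm_triangle scale_closed) auto
  also have "\<dots> \<le> 2"
    using v unitary_closed[OF f] unitary_closed[OF g] unitary_vnorm[OF f] unitary_vnorm[OF g]
    by (simp add: vnorm_scale)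
  finally show "vnorm V (vdiff V (f v) (g v)) \<le> 2" .
qed

lemma op_dist_ge:
  assumes "f \<in> unitaries V" "g \<in> unitaries V" "v \<in> vecs V" "vnorm V v \<le> 1"
  shows "vnorm V (vdiff V (f v) (g v)) \<le> op_dist V f g"
  unfolding op_dist_def by (rule cSUP_upper) (use assms op_dist_bdd in auto)

lemma op_dist_le:
  assumes "\<And>v. v \<in> vecs V \<Longrightarrow> vnorm V v \<le> 1 \<Longrightarrow> vnorm V (vdiff V (f v) (g v)) \<le> e"
  shows "op_dist V f g \<le> e"
proof -
  have "vzero V \<in> {v \<in> vecs V. vnorm V v \<le> 1}"
    using vnorm_eq_0_iff[OF zero_closed] by (simp add: zero_closed)
  then show ?thesis
    unfolding op_dist_def by (intro cSUP_least) (use assms in auto)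
qed

lemma
  shows mspace_unitary_metric: "mspace (unitary_metric V) = unitaries V"
    and mdist_unitary_metric:
      "f \<in> unitaries V \<Longrightarrow> g \<in> unitaries V \<Longrightarrow> mdist (unitary_metric V) f g = op_dist V f g"
proof -
  have dist: "vnorm V (vdiff V u v) = mdist (vmetric V) u v" if "u \<in> vecs V" "v \<in> vecs V" for u v
    using that by (simp add: mdist_vmetric)
  have 1: "0 \<le> op_dist V f g" if "f \<in> unitaries V" "g \<in> unitaries V" for f g
    using op_dist_ge[OF that zero_closed] vnorm_eq_0_iff[OF zero_closed] that
      vnorm_nonneg[OF diff_closed[OF unitary_closed unitary_closed], of f "vzero V" g "vzero V"]
    by (simp add: zero_closed)
  have 2: "op_dist V f g = op_dist V g f" if "f \<in> unitaries V" "g \<in> unitaries V" for f g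
    unfolding op_dist_def
    by (intro SUP_cong) (use that in \<open>auto simp: dist unitary_closed mdist_commute\<close>)
  have 3: "op_dist V f g = 0 \<longleftrightarrow> f = g" if fg: "f \<in> unitaries V" "g \<in> unitaries V" for f g
  proof
    assume eq: "op_dist V f g = 0"
    have ball: "f v = g v" if v: "v \<in> vecs V" "vnorm V v \<le> 1" for v
    proof -
      have c: "f v \<in> vecs V" "g v \<in> vecs V"
        using unitary_closed fg v by auto
      then have "mdist (vmetric V) (f v) (g v) = 0"
        using op_dist_ge[OF fg v] eq by (intro order.antisym) (simp_all add: dist)
      then show ?thesis
        using c by (simp add: mspace_vmetric)
    qed
    show "f = g"
    proof (rule extensionalityI[where A = "vecs V"])
      fix v assume v: "v \<in> vecs V"
      show "f v = g v"
      proof (cases "v = vzero V")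
        case True
        then show ?thesis
          using ball[OF v] vnorm_eq_0_iff[OF v] by simp
      next
        case False
        define r where "r = vnorm V v"
        have r: "r > 0" using False v vnorm_nonneg[OF v] vnorm_eq_0_iff[OF v] by (simp add: r_def)
        let ?w = "vscale V (of_real (1 / r)) v"
        have w: "?w \<in> vecs V" using v by (rule scale_closed)
        have "vnorm V ?w \<le> 1" using r v by (simp add: vnorm_scale norm_divide flip: r_def)
        then have "f ?w = g ?w" using ball w by blast
        moreover have "v = vscale V (of_real r) ?w"
          using r v by (simp add: scale_scale scale_one)
        ultimately show ?thesis
          using fg w unfolding unitaries_def unitary_map_def by auto metis
      qed
    qed (use fg in \<open>auto simp: unitaries_def\<close>)
  next
    assume eq: "f = g"
    have "op_dist V f g \<le> 0"
    proof (rule op_dist_le)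
      fix v assume v: "v \<in> vecs V"
      have "g v \<in> mspace (vmetric V)"
        unfolding mspace_vmetric by (rule unitary_closed[OF fg(2) v])
      then have "mdist (vmetric V) (g v) (g v) = 0" by simp
      then show "vnorm V (vdiff V (f v) (g v)) \<le> 0"
        using fg v by (simp add: eq dist unitary_closed)
    qed
    with 1[OF fg] show "op_dist V f g = 0" by simp
  qed
  have 4: "op_dist V f h \<le> op_dist V f g + op_dist V g h"
    if fgh: "f \<in> unitaries V" "g \<in> unitaries V" "h \<in> unitaries V" for f g h
  proof (rule op_dist_le)
    fix v assume v: "v \<in> vecs V" "vnorm V v \<le> 1"
    have "vnorm V (vdiff V (f v) (h v)) \<le> vnorm V (vdiff V (f v) (g v)) + vnorm V (vdiff V (g v) (h v))"
      using v fgh by (simp add: dist unitary_closed mspace_vmetric mdist_triangle)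
    also have "\<dots> \<le> op_dist V f g + op_dist V g h"
      by (intro add_mono op_dist_ge fgh v)
    finally show "vnorm V (vdiff V (f v) (h v)) \<le> op_dist V f g + op_dist V g h" .
  qed
  show "mspace (unitary_metric V) = unitaries V"
    unfolding unitary_metric_def by (rule metric_on(1)[OF 1 2 3 4])
  show "f \<in> unitaries V \<Longrightarrow> g \<in> unitaries V \<Longrightarrow> mdist (unitary_metric V) f g = op_dist V f g"
    unfolding unitary_metric_def by (rule metric_on(2)[OF 1 2 3 4])
qed

lemma openin_end_topology:
  "openin (end_topology V J b) S \<longleftrightarrow> S \<subseteq> end_unitaries V J b \<and>
     (\<forall>L. closedin (mtopology_of (submetric (unitary_metric V) (unitaries_prop_le V J b L)))
            ((end_unitaries V J b - S) \<inter> unitaries_prop_le V J b L))"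
proof -
  let ?U = "end_unitaries V J b" and ?P = "unitaries_prop_le V J b"
  let ?T = "\<lambda>L. mtopology_of (submetric (unitary_metric V) (?P L))"
  let ?O = "\<lambda>S. S \<subseteq> ?U \<and> (\<forall>L. closedin (?T L) ((?U - S) \<inter> ?P L))"
  have top: "topspace (?T L) = ?P L" for L
    by (auto simp: mspace_unitary_metric unitaries_prop_le_def)
  have PU: "?P L \<subseteq> ?U" for L
    by (auto simp: end_unitaries_def)
  have "istopology ?O"
    unfolding istopology_def
  proof (intro conjI allI impI)
    fix S T assume S: "?O S" and T: "?O T"
    show "S \<inter> T \<subseteq> ?U" using S by blast
    have "(?U - S \<inter> T) \<inter> ?P L = ((?U - S) \<inter> ?P L) \<union> ((?U - T) \<inter> ?P L)" for L
      by blast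
    then show "closedin (?T L) ((?U - S \<inter> T) \<inter> ?P L)" for L
      using S T closedin_Un by metis
  next
    fix K assume K: "\<forall>S\<in>K. ?O S"
    show "\<Union>K \<subseteq> ?U" using K by blast
    show "closedin (?T L) ((?U - \<Union>K) \<inter> ?P L)" for L
    proof (cases "K = {}")
      case True
      then show ?thesis
        using PU[of L] closedin_topspace[of "?T L"] top[of L] by (simp add: Int_absorb1)
    next
      case False
      then have eq: "(?U - \<Union>K) \<inter> ?P L = \<Inter>((\<lambda>S. (?U - S) \<inter> ?P L) ` K)"
        by auto
      show ?thesis
        unfolding eq by (rule closedin_Inter) (use K False in auto)
    qed
  qed
  then show ?thesis
    by (simp add: end_topology_def topology_inverse')
qed

lemma closedin_end_topology:
  "closedin (end_topology V J b) C \<longleftrightarrow> C \<subseteq> end_unitaries V J b \<and>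
     (\<forall>L. closedin (mtopology_of (submetric (unitary_metric V) (unitaries_prop_le V J b L)))
            (C \<inter> unitaries_prop_le V J b L))"
proof -
  let ?U = "end_unitaries V J b" and ?P = "unitaries_prop_le V J b"
  have "openin (end_topology V J b) ?U"
    by (simp add: openin_end_topology)
  then have "?U \<subseteq> topspace (end_topology V J b)"
    by (rule openin_subset)
  moreover have "topspace (end_topology V J b) \<subseteq> ?U"
    using openin_topspace[of "end_topology V J b"] unfolding openin_end_topology by (rule conjunct1)
  ultimately have top: "topspace (end_topology V J b) = ?U"
    by (rule subset_antisym[rotated])
  have "C \<subseteq> ?U \<Longrightarrow> ?U - (?U - C) = C" by blast
  then show ?thesis
    unfolding closedin_def[of "end_topology V J b"] top openin_end_topology by auto
qed

end


section \<open>Bundles\<close>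

record ('x, 'e) hermitian_family =
  tot :: "'e topology"
  pr :: "'e \<Rightarrow> 'x"
  fib :: "'x \<Rightarrow> 'e hermitian_space"

definition hermitian_family :: "'x topology \<Rightarrow> ('x, 'e) hermitian_family \<Rightarrow> bool" where
  "hermitian_family X B \<longleftrightarrow>
     continuous_map (tot B) X (pr B) \<and>
     (\<forall>x\<in>topspace X. inner_product_space (fib B x) \<and>
        vecs (fib B x) = {e \<in> topspace (tot B). pr B e = x})"

(* The function f is the fibre component of the trivialization. *)
definition trivialization ::
    "'x topology \<Rightarrow> ('x, 'e) hermitian_family \<Rightarrow> 'h hermitian_space \<Rightarrow> 'x set \<Rightarrow> ('e \<Rightarrow> 'h) \<Rightarrow> bool"
  where
  "trivialization X B H U f \<longleftrightarrow>
     homeomorphic_map (subtopology (tot B) {e. pr B e \<in> U})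
       (prod_topology (subtopology X U) (mtopology_of (vmetric H))) (\<lambda>e. (pr B e, f e)) \<and>
     (\<forall>x\<in>U. unitary_map (fib B x) H f)"

definition transition ::
    "('x, 'e) hermitian_family \<Rightarrow> 'h hermitian_space \<Rightarrow> ('e \<Rightarrow> 'h) \<Rightarrow> ('e \<Rightarrow> 'h) \<Rightarrow> 'x \<Rightarrow> 'h \<Rightarrow> 'h" where
  "transition B H f g x = (\<lambda>h\<in>vecs H. f (inv_into (vecs (fib B x)) g h))"

definition hermitian_vector_bundle ::
    "'x topology \<Rightarrow> nat \<Rightarrow> ('x, 'e) hermitian_family \<Rightarrow> bool" where
  "hermitian_vector_bundle X n E \<longleftrightarrow>
     hermitian_family X E \<and>
     (\<forall>x\<in>topspace X. \<exists>U f. openin X U \<and> x \<in> U \<and> trivialization X E (unitary_space n) U f)"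

(* Each fibre is isometric to H through a trivialization. The atlas is part of the structure: an infinite-dimensional Hilbert bundle over a paracompact
   base is trivial, so that for some other atlas all transition functions would be constant. *)
definition hilbert_bundle ::
    "'x topology \<Rightarrow> ('x, 'e) hermitian_family \<Rightarrow> 'h hermitian_space \<Rightarrow>
     'l set \<Rightarrow> ('l \<Rightarrow> 'x set) \<Rightarrow> ('l \<Rightarrow> 'e \<Rightarrow> 'h) \<Rightarrow> bool" where
  "hilbert_bundle X B H \<Lambda> U f \<longleftrightarrow>
     hilbert_space H \<and>
     hermitian_family X B \<and>
     (\<forall>l\<in>\<Lambda>. openin X (U l)) \<and> (\<Union>l\<in>\<Lambda>. U l) = topspace X \<and>
     (\<forall>l\<in>\<Lambda>. trivialization X B H (U l) (f l)) \<and>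
     (\<forall>l\<in>\<Lambda>. \<forall>m\<in>\<Lambda>. continuous_map (subtopology X (U l \<inter> U m))
        (mtopology_of (unitary_metric H)) (transition B H (f l) (f m)))"

definition hilbert_bundle_with_end ::
    "'x topology \<Rightarrow> ('x, 'e) hermitian_family \<Rightarrow> 'h hermitian_space \<Rightarrow> 'j metric \<Rightarrow> ('j \<Rightarrow> 'h) \<Rightarrow>
     'l set \<Rightarrow> ('l \<Rightarrow> 'x set) \<Rightarrow> ('l \<Rightarrow> 'e \<Rightarrow> 'h) \<Rightarrow> bool" where
  "hilbert_bundle_with_end X B H J b \<Lambda> U f \<longleftrightarrow>
     hilbert_bundle X B H \<Lambda> U f \<and>
     countable (mspace J) \<and> orthonormal_basis H (mspace J) b \<and>
     (\<forall>l\<in>\<Lambda>. \<forall>m\<in>\<Lambda>. continuous_map (subtopology X (U l \<inter> U m))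
        (end_topology H J b) (transition B H (f l) (f m)))"


section \<open>The completed sum\<close>

definition equicontinuous_family ::
    "'i set \<Rightarrow> 'a metric \<Rightarrow> ('i \<Rightarrow> 'b metric) \<Rightarrow> ('i \<Rightarrow> 'a \<Rightarrow> 'b) \<Rightarrow> bool" where
  "equicontinuous_family I A B f \<longleftrightarrow>
     (\<forall>\<epsilon>>0. \<exists>\<delta>>0. \<forall>i\<in>I. \<forall>a\<in>mspace A. \<forall>a'\<in>mspace A.
        mdist A a a' < \<delta> \<longrightarrow> mdist (B i) (f i a) (f i a') < \<epsilon>)"

(* The metric of I is first replaced by d + 1 off the diagonal, to have distinct points at
   distance at least 1. *)
definition pair_metric :: "'i metric \<Rightarrow> ('i \<Rightarrow> nat) \<Rightarrow> ('i \<times> nat) metric" where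
  "pair_metric I r = metric (SIGMA i:mspace I. {1..r i},
     \<lambda>(i, k) (j, l). if i \<noteq> j then mdist I i j + 1 else if k \<noteq> l then 1 else 0)"

lemma
  shows mspace_pair_metric: "mspace (pair_metric I r) = (SIGMA i:mspace I. {1..r i})"
    and mdist_pair_metric: "mdist (pair_metric I r) (i, k) (j, l) =
      (if i \<noteq> j then mdist I i j + 1 else if k \<noteq> l then 1 else 0)"
proof -
  let ?d = "\<lambda>(i, k) (j, l). if i \<noteq> j then mdist I i j + 1 else if k \<noteq> l then 1 else (0::real)"
  interpret Metric_space "SIGMA i:mspace I. {1..r i}" ?d
  proof
    show "0 \<le> ?d x y" for x y
      by (auto split: prod.split simp: add_nonneg_nonneg)
    show "?d x y = ?d y x" for x y
      by (auto split: prod.split simp: mdist_commute)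
    show "?d x y = 0 \<longleftrightarrow> x = y" for x y
      by (auto split: prod.split simp: add_nonneg_eq_0_iff)
    show "?d x z \<le> ?d x y + ?d y z"
      if "x \<in> (SIGMA i:mspace I. {1..r i})" "y \<in> (SIGMA i:mspace I. {1..r i})"
        "z \<in> (SIGMA i:mspace I. {1..r i})" for x y z
    proof -
      obtain i k j l m n where xyz: "x = (i, k)" "y = (j, l)" "z = (m, n)"
        by (metis surj_pair)
      have "0 \<le> mdist I i j" "0 \<le> mdist I j m" "mdist I i m \<le> mdist I i j + mdist I j m"
        using that by (auto simp: xyz intro: mdist_triangle)
      then show ?thesis
        by (auto simp: xyz simp del: mdist_nonneg)
    qed
  qed
  show "mspace (pair_metric I r) = (SIGMA i:mspace I. {1..r i})"
    unfolding pair_metric_def by (rule mspace_metric)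
  show "mdist (pair_metric I r) (i, k) (j, l) =
      (if i \<noteq> j then mdist I i j + 1 else if k \<noteq> l then 1 else 0)"
    unfolding pair_metric_def mdist_metric by simp
qed

definition tagged_space :: "'x \<Rightarrow> 'v hermitian_space \<Rightarrow> ('x \<times> 'v) hermitian_space" where
  "tagged_space x V =
     \<lparr>vecs = {x} \<times> vecs V,
      vzero = (x, vzero V),
      vadd = (\<lambda>u v. (x, vadd V (snd u) (snd v))),
      vscale = (\<lambda>c v. (x, vscale V c (snd v))),
      herm = (\<lambda>u v. herm V (snd u) (snd v))\<rparr>"

definition sum_trivialization ::
    "'i set \<Rightarrow> ('i \<Rightarrow> nat) \<Rightarrow> ('i \<Rightarrow> 'e \<Rightarrow> nat \<Rightarrow> complex) \<Rightarrow>
     'x \<times> ('i \<Rightarrow> 'e) \<Rightarrow> 'i \<times> nat \<Rightarrow> complex" where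
  "sum_trivialization I r f e = (\<lambda>(i, k)\<in>(SIGMA i:I. {1..r i}). f i (snd e i) k)"

(* The Hilbert completion of the direct sum of the fibres over x is realized by the
   square-summable families. The topology is generated by the preimages of open sets under the
   trivializations over the sets U l; the first component is tagged on to make the fibres
   disjoint even if I is empty. *)
definition completed_sum ::
    "'x topology \<Rightarrow> 'i set \<Rightarrow> ('i \<Rightarrow> ('x, 'e) hermitian_family) \<Rightarrow> ('i \<Rightarrow> nat) \<Rightarrow>
     'l set \<Rightarrow> ('l \<Rightarrow> 'x set) \<Rightarrow> ('l \<Rightarrow> 'i \<Rightarrow> 'e \<Rightarrow> nat \<Rightarrow> complex) \<Rightarrow>
     ('x, 'x \<times> ('i \<Rightarrow> 'e)) hermitian_family" where
  "completed_sum X I E r \<Lambda> U f =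
     \<lparr>tot = topology_generated_by
        {{(x, v). x \<in> U l \<and> v \<in> vecs (hilbert_sum I (\<lambda>i. fib (E i) x)) \<and>
            (x, sum_trivialization I r (f l) (x, v)) \<in> W} | l W.
          l \<in> \<Lambda> \<and>
          openin (prod_topology X (mtopology_of (vmetric (ell2 (SIGMA i:I. {1..r i}))))) W},
      pr = fst,
      fib = (\<lambda>x. tagged_space x (hilbert_sum I (\<lambda>i. fib (E i) x)))\<rparr>"

end

theory Submission
  imports Defs
begin

text \<open>
  Over each \<open>U l\<close> the orthogonal direct sum of the trivializations of the \<open>E i\<close> is a fibrewise
  unitary map onto the Hilbert sum of the spaces \<open>unitary_space (r i)\<close>, and putting coordinates
  side by side identifies that sum with one sequence space whose basis is indexed by the pairs
  \<open>(i, k)\<close> (\<open>unitary_map_direct_sum\<close>, \<open>unitary_map_flatten\<close>). In these charts the transition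
  function of the completed sum at a point is the block diagonal operator whose blocks are the
  transition functions of the \<open>E i\<close> at that point (\<open>sum_transition_block\<close>). Everything follows
  from this.

  The operator norm of a block diagonal operator is the supremum of the norms of its blocks
  (\<open>op_dist_direct_sum_le\<close>). Equicontinuity makes all blocks close at the same time, so the
  transition functions are continuous in operator norm (\<open>continuous_map_sum_transition\<close>);
  continuity of the single blocks would only give strong continuity. A block diagonal matrix has non-zero entries only
  at pairs \<open>(i, k)\<close>, \<open>(i, l)\<close> with the same \<open>i\<close>, which are at distance at most \<open>1\<close>, so that all
  transition functions have values in the unitary operators of propagation at most \<open>1\<close>
  (\<open>block_operator_propagation\<close>). A norm continuous map into one stage of an inductive limit is
  continuous into the limit (\<open>continuous_map_end_topology\<close>), and this gives the end.

  What remains is that the charts are homeomorphisms. The topology of the total space is the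
  coarsest one that contains the preimages of open sets under all charts. A chart is therefore
  continuous, and its inverse is continuous as soon as the changes of charts
  \<open>(x, h) \<mapsto> (x, T x h)\<close> are. This holds because \<open>T\<close> is norm continuous and its values are
  isometries (\<open>continuous_map_unitary_action\<close>, \<open>trivialization_B\<close>).
\<close>

section \<open>Unitary maps\<close>

lemma unitary_mapD:
  assumes "unitary_map V W f"
  shows "v \<in> vecs V \<Longrightarrow> f v \<in> vecs W"
    and "u \<in> vecs V \<Longrightarrow> v \<in> vecs V \<Longrightarrow> f (vadd V u v) = vadd W (f u) (f v)"
    and "v \<in> vecs V \<Longrightarrow> f (vscale V c v) = vscale W c (f v)"
    and "u \<in> vecs V \<Longrightarrow> v \<in> vecs V \<Longrightarrow> herm W (f u) (f v) = herm V u v"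
    and "v \<in> vecs V \<Longrightarrow> vnorm W (f v) = vnorm V v"
    and "v \<in> vecs V \<Longrightarrow> inv_into (vecs V) f (f v) = v"
    and "w \<in> vecs W \<Longrightarrow> inv_into (vecs V) f w \<in> vecs V"
    and "w \<in> vecs W \<Longrightarrow> f (inv_into (vecs V) f w) = w"
  using assms
  by (auto simp: unitary_map_def bij_betw_def vnorm_def inv_into_into f_inv_into_f)

lemma unitary_map_diff:
  assumes "inner_product_space V" "unitary_map V W f" "u \<in> vecs V" "v \<in> vecs V"
  shows "f (vdiff V u v) = vdiff W (f u) (f v)"
  using assms by (simp add: vdiff_def unitary_mapD inner_product_space.scale_closed)

lemma (in inner_product_space) diff_self: "v \<in> vecs V \<Longrightarrow> vdiff V v v = vzero V"
  by (simp add: vdiff_def add_neg)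

lemma unitary_map_zero:
  assumes V: "inner_product_space V" and W: "inner_product_space W" and f: "unitary_map V W f"
  shows "f (vzero V) = vzero W"
proof -
  note z = inner_product_space.zero_closed[OF V]
  have "f (vzero V) = f (vdiff V (vzero V) (vzero V))"
    using inner_product_space.diff_self[OF V z] by simp
  also have "\<dots> = vzero W"
    using unitary_map_diff[OF V f z z] inner_product_space.diff_self[OF W unitary_mapD(1)[OF f z]]
    by simp
  finally show ?thesis .
qed

text \<open>Injectivity comes for free, since a linear map that preserves the inner product has zero
  kernel.\<close>

lemma unitary_mapI:
  assumes V: "inner_product_space V" and W: "inner_product_space W"
    and closed: "\<And>v. v \<in> vecs V \<Longrightarrow> f v \<in> vecs W"
    and surj: "\<And>w. w \<in> vecs W \<Longrightarrow> \<exists>v\<in>vecs V. f v = w"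
    and add: "\<And>u v. u \<in> vecs V \<Longrightarrow> v \<in> vecs V \<Longrightarrow> f (vadd V u v) = vadd W (f u) (f v)"
    and scale: "\<And>c v. v \<in> vecs V \<Longrightarrow> f (vscale V c v) = vscale W c (f v)"
    and herm: "\<And>u v. u \<in> vecs V \<Longrightarrow> v \<in> vecs V \<Longrightarrow> herm W (f u) (f v) = herm V u v"
  shows "unitary_map V W f"
proof -
  interpret V: inner_product_space V by fact
  interpret W: inner_product_space W by fact
  have "inj_on f (vecs V)"
  proof (rule inj_onI)
    fix u v assume uv: "u \<in> vecs V" "v \<in> vecs V" and eq: "f u = f v"
    have "f (vdiff V u v) = vdiff W (f u) (f v)"
      using uv by (simp add: vdiff_def add scale V.scale_closed)
    also have "\<dots> = vzero W" using uv by (simp add: eq W.diff_self closed)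
    finally have "vnorm V (vdiff V u v) = vnorm W (vzero W)"
      using uv herm[of "vdiff V u v" "vdiff V u v"] by (simp add: vnorm_def V.diff_closed)
    then have "mdist (vmetric V) u v = 0"
      using uv by (simp add: V.mdist_vmetric W.vnorm_eq_0_iff W.zero_closed)
    then show "u = v" using uv by (simp add: V.mspace_vmetric)
  qed
  then show ?thesis
    using closed surj add scale herm unfolding unitary_map_def bij_betw_def by fastforce
qed

lemma unitary_map_comp:
  assumes f: "unitary_map V W f" and g: "unitary_map W Z g"
  shows "unitary_map V Z (\<lambda>v. g (f v))"
proof -
  have "bij_betw (g \<circ> f) (vecs V) (vecs Z)"
    using f g bij_betw_trans by (auto simp: unitary_map_def)
  then show ?thesis
    using unitary_mapD[OF f] unitary_mapD[OF g] by (simp add: unitary_map_def comp_def)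
qed

lemma unitary_map_cong:
  assumes "inner_product_space V" "\<And>v. v \<in> vecs V \<Longrightarrow> f v = g v"
  shows "unitary_map V W f \<longleftrightarrow> unitary_map V W g"
proof -
  have "bij_betw f (vecs V) (vecs W) \<longleftrightarrow> bij_betw g (vecs V) (vecs W)"
    using assms(2) by (rule bij_betw_cong)
  then show ?thesis
    using assms
    by (simp add: unitary_map_def inner_product_space.add_closed inner_product_space.scale_closed)
qed

lemma unitary_map_inv:
  assumes V: "inner_product_space V" and W: "inner_product_space W" and f: "unitary_map V W f"
  shows "unitary_map W V (inv_into (vecs V) f)"
proof (rule unitary_mapI[OF W V])
  let ?g = "inv_into (vecs V) f"
  note D = unitary_mapD[OF f]
  show "?g w \<in> vecs V" if "w \<in> vecs W" for w using D(7) that .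
  show "\<exists>w\<in>vecs W. ?g w = v" if "v \<in> vecs V" for v using D(1,6) that by blast
  show "?g (vadd W u v) = vadd V (?g u) (?g v)" if "u \<in> vecs W" "v \<in> vecs W" for u v
    using D(6)[of "vadd V (?g u) (?g v)"] that by (simp add: D inner_product_space.add_closed[OF V])
  show "?g (vscale W c v) = vscale V c (?g v)" if "v \<in> vecs W" for c v
    using D(6)[of "vscale V c (?g v)"] that by (simp add: D inner_product_space.scale_closed[OF V])
  show "herm V (?g u) (?g v) = herm W u v" if "u \<in> vecs W" "v \<in> vecs W" for u v
    using D(4)[of "?g u" "?g v"] that by (simp add: D)
qed

lemma transition_unitary:
  assumes V: "inner_product_space (fib B x)" and H: "inner_product_space H"
    and f: "unitary_map (fib B x) H f" and g: "unitary_map (fib B x) H g"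
  shows "transition B H f g x \<in> unitaries H"
proof -
  have "unitary_map H H (\<lambda>h. f (inv_into (vecs (fib B x)) g h))"
    by (rule unitary_map_comp[OF unitary_map_inv[OF V H g] f])
  then have "unitary_map H H (transition B H f g x)"
    by (subst unitary_map_cong[OF H, of _ "\<lambda>h. f (inv_into (vecs (fib B x)) g h)"])
      (simp_all add: transition_def)
  then show ?thesis by (simp add: unitaries_def transition_def)
qed

lemma transition_apply:
  assumes "unitary_map (fib B x) H g" "v \<in> vecs (fib B x)"
  shows "transition B H f g x (g v) = f v"
  using assms by (simp add: transition_def unitary_mapD)

text \<open>The supremum that defines \<open>op_dist\<close> runs over the unit ball; homogeneity extends its bound
  to all vectors.\<close>

lemma (in inner_product_space) op_dist_bound:
  assumes f: "f \<in> unitaries V" and g: "g \<in> unitaries V" and v: "v \<in> vecs V"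
  shows "vnorm V (vdiff V (f v) (g v)) \<le> op_dist V f g * vnorm V v"
proof (cases "v = vzero V")
  case True
  have "unitary_map V V f" "unitary_map V V g" using f g by (auto simp: unitaries_def)
  then have "f v = vzero V" "g v = vzero V"
    using unitary_map_zero[OF inner_product_space_axioms inner_product_space_axioms] True by auto
  then show ?thesis
    using vnorm_eq_0_iff[OF zero_closed] True by (simp add: diff_self zero_closed)
next
  case False
  have uf: "unitary_map V V f" and ug: "unitary_map V V g" using f g by (auto simp: unitaries_def)
  define a where "a = vnorm V v"
  have a: "a > 0" using False v vnorm_nonneg[OF v] vnorm_eq_0_iff[OF v] by (simp add: a_def)
  let ?c = "complex_of_real (1 / a)"
  have "vnorm V (vdiff V (f (vscale V ?c v)) (g (vscale V ?c v))) \<le> op_dist V f g"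
    using a v by (intro op_dist_ge f g) (simp_all add: scale_closed vnorm_scale norm_divide flip: a_def)
  also have "vdiff V (f (vscale V ?c v)) (g (vscale V ?c v)) = vscale V ?c (vdiff V (f v) (g v))"
    using v unitary_mapD(1,3)[OF uf] unitary_mapD(1,3)[OF ug]
    by (simp add: vdiff_def scale_add_right scale_closed scale_scale)
  also have "vnorm V \<dots> = vnorm V (vdiff V (f v) (g v)) / a"
    using a v f g by (simp add: vnorm_scale diff_closed unitary_closed norm_divide)
  finally show ?thesis using a by (simp add: field_simps a_def)
qed

section \<open>Orthogonal direct sums\<close>

text \<open>Square summability is preserved in both directions because each summand is an isometry.\<close>

lemma unitary_map_direct_sum:
  assumes V: "\<And>i. i \<in> I \<Longrightarrow> inner_product_space (V i)"
    and W: "\<And>i. i \<in> I \<Longrightarrow> inner_product_space (W i)"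
    and f: "\<And>i. i \<in> I \<Longrightarrow> unitary_map (V i) (W i) (f i)"
  shows "unitary_map (hilbert_sum I V) (hilbert_sum I W) (\<lambda>v. \<lambda>i\<in>I. f i (v i))"
proof (rule unitary_mapI)
  let ?F = "\<lambda>v. \<lambda>i\<in>I. f i (v i)"
  note memD = hilbert_sum_memD[where V = V, OF V] hilbert_sum_memD[where V = W, OF W]
  note ext = extensionalityI[where A = I]
  show "inner_product_space (hilbert_sum I V)" "inner_product_space (hilbert_sum I W)"
    using V W by (auto intro: inner_product_space_hilbert_sum)
  show "?F v \<in> vecs (hilbert_sum I W)" if v: "v \<in> vecs (hilbert_sum I V)" for v
    by (rule hilbert_sum_memI[OF W _ _ memD(3)[OF _ v]])
      (use v memD(1) V in \<open>auto simp: unitary_mapD[OF f]\<close>)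
  show "\<exists>v\<in>vecs (hilbert_sum I V). ?F v = w" if w: "w \<in> vecs (hilbert_sum I W)" for w
  proof
    let ?v = "\<lambda>i\<in>I. inv_into (vecs (V i)) (f i) (w i)"
    have wi: "w i \<in> vecs (W i)" if "i \<in> I" for i using memD(4)[OF _ w that] by blast
    have "vnorm (V i) (?v i) = vnorm (W i) (w i)" if "i \<in> I" for i
      using that unitary_mapD(5,7,8)[OF f[OF that]] wi[OF that] by simp metis
    then show "?v \<in> vecs (hilbert_sum I V)"
      by (intro hilbert_sum_memI[OF V _ _ memD(6)[OF _ w]])
        (use W wi in \<open>auto simp: unitary_mapD[OF f]\<close>)
    show "?F ?v = w"
      by (rule ext) (use memD(5)[OF _ w] W wi in \<open>auto simp: unitary_mapD[OF f]\<close>)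
  qed
  show "?F (vadd (hilbert_sum I V) u v) = vadd (hilbert_sum I W) (?F u) (?F v)"
    if "u \<in> vecs (hilbert_sum I V)" "v \<in> vecs (hilbert_sum I V)" for u v
    by (rule ext) (use that V memD(1) in \<open>auto simp: hilbert_sum_simps(3) unitary_mapD[OF f]\<close>)
  show "?F (vscale (hilbert_sum I V) c v) = vscale (hilbert_sum I W) c (?F v)"
    if "v \<in> vecs (hilbert_sum I V)" for c v
    by (rule ext) (use that V memD(1) in \<open>auto simp: hilbert_sum_simps(4) unitary_mapD[OF f]\<close>)
  show "herm (hilbert_sum I W) (?F u) (?F v) = herm (hilbert_sum I V) u v"
    if "u \<in> vecs (hilbert_sum I V)" "v \<in> vecs (hilbert_sum I V)" for u v
    unfolding hilbert_sum_simps(5)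
    by (intro infsum_cong) (use that V memD(1) in \<open>auto simp: unitary_mapD[OF f]\<close>)
qed

lemma inner_product_space_ell2: "inner_product_space (ell2 J)"
  using hilbert_space_ell2 by (auto simp: hilbert_space_def)

lemma inner_product_space_complex_line: "inner_product_space complex_line"
  using hilbert_space_complex_line by (auto simp: hilbert_space_def)

lemma vnorm_complex_line: "vnorm complex_line z = cmod z"
  by (simp add: vnorm_def complex_line_def cmod_def power2_eq_square)

lemma ell2_simps:
  "vecs (ell2 J) = {v \<in> extensional J. (\<lambda>j. (cmod (v j))\<^sup>2) summable_on J}"
  "vadd (ell2 J) u v = (\<lambda>j\<in>J. u j + v j)"
  "vscale (ell2 J) c v = (\<lambda>j\<in>J. c * v j)"
  "vzero (ell2 J) = (\<lambda>j\<in>J. 0)"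
  "herm (ell2 J) u v = (\<Sum>\<^sub>\<infinity>j\<in>J. u j * cnj (v j))"
  by (auto simp: ell2_def hilbert_sum_simps vnorm_complex_line PiE_def)
    (auto simp: complex_line_def)

lemma ell2_herm_summable:
  "u \<in> vecs (ell2 J) \<Longrightarrow> v \<in> vecs (ell2 J) \<Longrightarrow> (\<lambda>j. u j * cnj (v j)) summable_on J"
  using hilbert_sum_herm_summable[OF inner_product_space_complex_line, of u J v]
  by (simp add: ell2_def) (simp add: complex_line_def)

lemma vnorm_ell2: "v \<in> vecs (ell2 J) \<Longrightarrow> (vnorm (ell2 J) v)\<^sup>2 = (\<Sum>\<^sub>\<infinity>j\<in>J. (cmod (v j))\<^sup>2)"
  using vnorm_hilbert_sum[OF inner_product_space_complex_line, of v J]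
  by (simp add: ell2_def vnorm_complex_line)

definition flatten :: "'i set \<Rightarrow> ('i \<Rightarrow> 'k set) \<Rightarrow> ('i \<Rightarrow> 'k \<Rightarrow> complex) \<Rightarrow> 'i \<times> 'k \<Rightarrow> complex" where
  "flatten I A v = (\<lambda>(i, k)\<in>Sigma I A. v i k)"

lemma summable_on_Sigma_iff_nonneg:
  fixes g :: "'i \<times> 'k \<Rightarrow> real"
  assumes "\<And>p. 0 \<le> g p"
  shows "g summable_on Sigma I A \<longleftrightarrow>
    (\<forall>i\<in>I. (\<lambda>k. g (i, k)) summable_on A i) \<and> (\<lambda>i. \<Sum>\<^sub>\<infinity>k\<in>A i. g (i, k)) summable_on I"
  using Infinite_Sum.abs_summable_on_Sigma_iff[where f = g and A = I and B = A] assms by (simp add: infsum_nonneg)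

text \<open>This is Fubini's theorem for unconditionally convergent sums, applied to the squares of the
  coordinates for square summability and to their products for the inner product.\<close>

lemma unitary_map_flatten:
  "unitary_map (hilbert_sum I (\<lambda>i. ell2 (A i))) (ell2 (Sigma I A)) (flatten I A)"
proof (rule unitary_mapI)
  let ?S = "hilbert_sum I (\<lambda>i. ell2 (A i))" and ?L = "ell2 (Sigma I A)"
  note ext = extensionalityI[where A = "Sigma I A"]
  note memD = hilbert_sum_memD[where V = "\<lambda>i. ell2 (A i)", OF inner_product_space_ell2]
  show "inner_product_space ?S"
    by (intro inner_product_space_hilbert_sum inner_product_space_ell2)
  show "inner_product_space ?L" by (rule inner_product_space_ell2)
  show closed: "flatten I A v \<in> vecs ?L" if v: "v \<in> vecs ?S" for v
  proof -
    have vi: "v i \<in> vecs (ell2 (A i))" if "i \<in> I" for i using memD(1)[OF v that] .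
    have "(\<lambda>i. \<Sum>\<^sub>\<infinity>k\<in>A i. (cmod (v i k))\<^sup>2) summable_on I"
      using memD(3)[OF v] by (rule summable_on_cong[THEN iffD1, rotated]) (simp add: vnorm_ell2 vi)
    then have "(\<lambda>(i, k). (cmod (v i k))\<^sup>2) summable_on Sigma I A"
      using vi by (subst summable_on_Sigma_iff_nonneg) (auto simp: ell2_simps(1))
    then have "(\<lambda>p. (cmod (flatten I A v p))\<^sup>2) summable_on Sigma I A"
      by (rule summable_on_cong[THEN iffD1, rotated]) (auto simp: flatten_def)
    then show ?thesis by (auto simp: ell2_simps(1) flatten_def)
  qed
  show "\<exists>v\<in>vecs ?S. flatten I A v = w" if w: "w \<in> vecs ?L" for w
  proof
    let ?v = "\<lambda>i\<in>I. \<lambda>k\<in>A i. w (i, k)"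
    have sm: "\<forall>i\<in>I. (\<lambda>k. (cmod (w (i, k)))\<^sup>2) summable_on A i"
      "(\<lambda>i. \<Sum>\<^sub>\<infinity>k\<in>A i. (cmod (w (i, k)))\<^sup>2) summable_on I"
      using w summable_on_Sigma_iff_nonneg[of "\<lambda>p. (cmod (w p))\<^sup>2" I A]
      by (auto simp: ell2_simps(1))
    have vi: "?v i \<in> vecs (ell2 (A i))" if "i \<in> I" for i
      using sm(1) that by (simp add: ell2_simps(1) cong: summable_on_cong)
    show "?v \<in> vecs ?S"
    proof (rule hilbert_sum_memI[OF inner_product_space_ell2 _ _ sm(2)])
      show "(vnorm (ell2 (A i)) (?v i))\<^sup>2 \<le> (\<Sum>\<^sub>\<infinity>k\<in>A i. (cmod (w (i, k)))\<^sup>2)" if "i \<in> I" for i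
        unfolding vnorm_ell2[OF vi[OF that]] using that by (simp cong: infsum_cong)
    qed (use vi in auto)
    show "flatten I A ?v = w"
      by (rule ext) (use w in \<open>auto simp: flatten_def ell2_simps(1)\<close>)
  qed
  show "flatten I A (vadd ?S u v) = vadd ?L (flatten I A u) (flatten I A v)" for u v
    by (rule ext) (auto simp: flatten_def ell2_simps hilbert_sum_simps)
  show "flatten I A (vscale ?S c v) = vscale ?L c (flatten I A v)" for c v
    by (rule ext) (auto simp: flatten_def ell2_simps hilbert_sum_simps)
  show "herm ?L (flatten I A u) (flatten I A v) = herm ?S u v"
    if u: "u \<in> vecs ?S" and v: "v \<in> vecs ?S" for u v
  proof -
    let ?g = "\<lambda>p. flatten I A u p * cnj (flatten I A v p)"
    have "herm ?L (flatten I A u) (flatten I A v) = infsum ?g (Sigma I A)"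
      by (simp add: ell2_simps(5))
    also have "\<dots> = (\<Sum>\<^sub>\<infinity>i\<in>I. \<Sum>\<^sub>\<infinity>k\<in>A i. ?g (i, k))"
      using ell2_herm_summable[OF closed[OF u] closed[OF v]]
      by (rule infsum_Sigma_banach[symmetric])
    also have "\<dots> = (\<Sum>\<^sub>\<infinity>i\<in>I. herm (ell2 (A i)) (u i) (v i))"
      by (intro infsum_cong) (auto simp: ell2_simps(5) flatten_def intro!: infsum_cong)
    finally show ?thesis by (simp add: hilbert_sum_simps(5))
  qed
qed

section \<open>Block operators\<close>

text \<open>The operators are only known through a unitary identification \<open>F\<close> of their space with a
  direct sum, as transition functions are. Since \<open>F\<close> is an isometry, the difference can be
  estimated block by block in the sum, and the squares of the estimates add up.\<close>

lemma op_dist_direct_sum_le: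
  assumes V: "\<And>i. i \<in> I \<Longrightarrow> inner_product_space (V i)"
    and H: "inner_product_space H"
    and F: "unitary_map (hilbert_sum I V) H F"
    and t: "\<And>i. i \<in> I \<Longrightarrow> t i \<in> unitaries (V i)" "\<And>i. i \<in> I \<Longrightarrow> t' i \<in> unitaries (V i)"
    and T: "\<And>s. s \<in> vecs (hilbert_sum I V) \<Longrightarrow> T (F s) = F (\<lambda>i\<in>I. t i (s i))"
    and T': "\<And>s. s \<in> vecs (hilbert_sum I V) \<Longrightarrow> T' (F s) = F (\<lambda>i\<in>I. t' i (s i))"
    and e: "0 \<le> e" "\<And>i. i \<in> I \<Longrightarrow> op_dist (V i) (t i) (t' i) \<le> e"
  shows "op_dist H T T' \<le> e"
proof (rule inner_product_space.op_dist_le[OF H])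
  let ?S = "hilbert_sum I V"
  note S = inner_product_space_hilbert_sum[where I = I and V = V, OF V]
  note memD = hilbert_sum_memD[where V = V, OF V]
  fix h assume h: "h \<in> vecs H" "vnorm H h \<le> 1"
  define s where "s = inv_into (vecs ?S) F h"
  have s: "s \<in> vecs ?S" and Fs: "F s = h"
    using unitary_mapD(7,8)[OF F h(1)] by (simp_all add: s_def)
  let ?u = "\<lambda>i\<in>I. t i (s i)" and ?u' = "\<lambda>i\<in>I. t' i (s i)"
  have u: "?u \<in> vecs ?S" "?u' \<in> vecs ?S"
    by (rule unitary_mapD(1)[OF unitary_map_direct_sum s]; use V t in \<open>auto simp: unitaries_def\<close>)+
  let ?w = "vdiff ?S ?u ?u'"
  have w: "?w \<in> vecs ?S" using inner_product_space.diff_closed[OF S u] by simp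
  have le: "(vnorm (V i) (?w i))\<^sup>2 \<le> e\<^sup>2 * (vnorm (V i) (s i))\<^sup>2" if i: "i \<in> I" for i
  proof -
    interpret Vi: inner_product_space "V i" by (rule V[OF i])
    have si: "s i \<in> vecs (V i)" using memD(1)[OF _ s i] by blast
    have "vnorm (V i) (?w i) \<le> op_dist (V i) (t i) (t' i) * vnorm (V i) (s i)"
      using i Vi.op_dist_bound[OF t(1)[OF i] t(2)[OF i] si] by (simp add: vdiff_hilbert_sum)
    also have "\<dots> \<le> e * vnorm (V i) (s i)"
      using e(2)[OF i] Vi.vnorm_nonneg[OF si] by (rule mult_right_mono)
    finally have "(vnorm (V i) (?w i))\<^sup>2 \<le> (e * vnorm (V i) (s i))\<^sup>2"
      using memD(1)[OF _ w i] Vi.vnorm_nonneg by (intro power_mono) auto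
    then show ?thesis by (simp add: power_mult_distrib)
  qed
  have "vdiff H (T h) (T' h) = F ?w"
    using unitary_map_diff[OF _ F u] S T[OF s] T'[OF s] Fs by simp
  then have "(vnorm H (vdiff H (T h) (T' h)))\<^sup>2 = (vnorm ?S ?w)\<^sup>2"
    using unitary_mapD(5)[OF F w] by simp
  also have "\<dots> = (\<Sum>\<^sub>\<infinity>i\<in>I. (vnorm (V i) (?w i))\<^sup>2)"
    using V w by (intro vnorm_hilbert_sum)
  also have "\<dots> \<le> (\<Sum>\<^sub>\<infinity>i\<in>I. e\<^sup>2 * (vnorm (V i) (s i))\<^sup>2)"
    by (intro infsum_mono summable_on_cmult_right le memD(3)[OF _ w] memD(3)[OF _ s])
  also have "\<dots> = e\<^sup>2 * (vnorm ?S s)\<^sup>2"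
    using vnorm_hilbert_sum[of I V, OF V s] by (simp add: infsum_cmult_right')
  also have "\<dots> = e\<^sup>2 * (vnorm H h)\<^sup>2"
    using unitary_mapD(5)[OF F s] Fs by simp
  also have "\<dots> \<le> e\<^sup>2 * 1"
    using h inner_product_space.vnorm_nonneg[OF H] by (intro mult_left_mono power_le_one) auto
  finally have "(vnorm H (vdiff H (T h) (T' h)))\<^sup>2 \<le> e\<^sup>2" by simp
  then show "vnorm H (vdiff H (T h) (T' h)) \<le> e"
    using e(1) by (rule power2_le_imp_le)
qed

lemma std_basis_mem: "j \<in> J \<Longrightarrow> std_basis J j \<in> vecs (ell2 J)"
  by (auto simp: ell2_simps(1) std_basis_def intro!: finite_nonzero_values_imp_summable_on
      intro: finite_subset[of _ "{j}"])

lemma herm_std_basis: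
  assumes "j \<in> J"
  shows "herm (ell2 J) v (std_basis J j) = v j"
proof -
  have "herm (ell2 J) v (std_basis J j) = (\<Sum>\<^sub>\<infinity>i\<in>{j}. v i)"
    unfolding ell2_simps(5) using assms by (intro infsum_cong_neutral) (auto simp: std_basis_def)
  then show ?thesis by simp
qed

lemma orthonormal_basis_std_basis: "orthonormal_basis (ell2 J) J (std_basis J)"
  unfolding orthonormal_basis_def
proof (intro conjI ballI impI)
  show "std_basis J j \<in> vecs (ell2 J)" if "j \<in> J" for j using that by (rule std_basis_mem)
  show "herm (ell2 J) (std_basis J i) (std_basis J j) = (if i = j then 1 else 0)"
    if "i \<in> J" "j \<in> J" for i j
    using that by (simp add: herm_std_basis) (simp add: std_basis_def)
  show "v = vzero (ell2 J)"
    if "v \<in> vecs (ell2 J)" "\<forall>j\<in>J. herm (ell2 J) v (std_basis J j) = 0" for v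
    by (rule extensionalityI[where A = J]) (use that in \<open>auto simp: herm_std_basis ell2_simps(1,4)\<close>)
qed

text \<open>The basis vector at \<open>(j, l)\<close> vanishes on each block \<open>i \<noteq> j\<close>, and so does its image, because a
  linear map fixes zero. The bound \<open>1\<close> is the distance of distinct indices of one block in
  \<open>pair_metric\<close>.\<close>

lemma block_operator_propagation:
  fixes I :: "'i metric" and r :: "'i \<Rightarrow> nat"
  defines "A \<equiv> \<lambda>i. {1..r i}" and "J \<equiv> mspace (pair_metric I r)"
  assumes t: "\<And>i. i \<in> mspace I \<Longrightarrow> t i \<in> unitaries (ell2 (A i))"
    and T: "\<And>s. s \<in> vecs (hilbert_sum (mspace I) (\<lambda>i. ell2 (A i))) \<Longrightarrow>
          T (flatten (mspace I) A s) = flatten (mspace I) A (\<lambda>i\<in>mspace I. t i (s i))"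
  shows "propagation (ell2 J) (pair_metric I r) (std_basis J) T \<le> ereal 1"
  unfolding propagation_def
proof (rule SUP_least)
  let ?S = "hilbert_sum (mspace I) (\<lambda>i. ell2 (A i))"
  have J: "J = Sigma (mspace I) A" by (simp add: J_def A_def mspace_pair_metric)
  fix p assume p: "p \<in> {(p, q). p \<in> mspace (pair_metric I r) \<and> q \<in> mspace (pair_metric I r) \<and>
      herm (ell2 J) (T (std_basis J q)) (std_basis J p) \<noteq> 0}"
  then obtain i k j l where ik: "p = ((i, k), (j, l))" "(i, k) \<in> J" "(j, l) \<in> J"
    and "herm (ell2 J) (T (std_basis J (j, l))) (std_basis J (i, k)) \<noteq> 0"
    by (auto simp: J_def)
  then have nz: "T (std_basis J (j, l)) (i, k) \<noteq> 0" by (simp add: herm_std_basis)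
  have i: "i \<in> mspace I" and k: "k \<in> A i" using ik(2) by (auto simp: J)
  have "i = j"
  proof (rule ccontr)
    assume ij: "i \<noteq> j"
    have flat: "unitary_map ?S (ell2 J) (flatten (mspace I) A)"
      unfolding J by (rule unitary_map_flatten)
    define s where "s = inv_into (vecs ?S) (flatten (mspace I) A) (std_basis J (j, l))"
    have s: "s \<in> vecs ?S" and fs: "flatten (mspace I) A s = std_basis J (j, l)"
      using unitary_mapD(7,8)[OF flat std_basis_mem[OF ik(3)]] by (simp_all add: s_def)
    have "s i \<in> vecs (ell2 (A i))"
      using hilbert_sum_memD(1)[OF inner_product_space_ell2 s i] .
    moreover have "s i k' = 0" if "k' \<in> A i" for k'
      using fun_cong[OF fs, of "(i, k')"] ij i that by (auto simp: flatten_def std_basis_def J)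
    ultimately have "s i = vzero (ell2 (A i))"
      by (intro extensionalityI[where A = "A i"]) (auto simp: ell2_simps)
    then have "t i (s i) = vzero (ell2 (A i))"
      using unitary_map_zero[OF inner_product_space_ell2 inner_product_space_ell2] t[OF i]
      by (auto simp: unitaries_def)
    moreover have "T (std_basis J (j, l)) = flatten (mspace I) A (\<lambda>i\<in>mspace I. t i (s i))"
      using T[OF s] by (simp add: fs)
    ultimately have "T (std_basis J (j, l)) (i, k) = 0"
      using i k by (simp add: flatten_def ell2_simps)
    with nz show False ..
  qed
  then show "(case p of (p, q) \<Rightarrow> ereal (mdist (pair_metric I r) p q)) \<le> ereal 1"
    by (simp add: ik(1) mdist_pair_metric)
qed

section \<open>Continuity of unitary-valued maps\<close>

lemma openin_mball_of: "openin (mtopology_of m) (mball_of m x e)"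
  unfolding mtopology_of_def mball_of_def by (simp add: Metric_space.openin_mball)

lemma centre_in_mball_of: "x \<in> mspace m \<Longrightarrow> 0 < e \<Longrightarrow> x \<in> mball_of m x e"
  by (metis in_mball_of mdist_zero)

lemma continuous_map_into_mtopology_of:
  "continuous_map Z (mtopology_of m) f \<longleftrightarrow> f \<in> topspace Z \<rightarrow> mspace m \<and>
     (\<forall>z\<in>topspace Z. \<forall>e>0. \<exists>N. openin Z N \<and> z \<in> N \<and> (\<forall>y\<in>N. mdist m (f z) (f y) < e))"
  (is "?L \<longleftrightarrow> ?R")
proof -
  interpret Metric_space "mspace m" "mdist m" by simp
  have eq: "?L \<longleftrightarrow> (\<forall>z\<in>topspace Z. \<forall>e>0. \<exists>N. openin Z N \<and> z \<in> N \<and> (\<forall>y\<in>N. f y \<in> mball (f z) e))"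
    unfolding mtopology_of_def by (rule continuous_map_to_metric)
  show ?thesis
  proof
    assume L: ?L
    have "f \<in> topspace Z \<rightarrow> mspace m" using continuous_map_funspace[OF L] by simp
    then show ?R using L unfolding eq by fastforce
  next
    assume R: ?R
    then have "f y \<in> mspace m" if "openin Z N" "y \<in> N" for N y
      using openin_subset[OF that(1)] that(2) by auto
    then show ?L using R unfolding eq in_mball by (meson subsetD openin_subset)
  qed
qed

text \<open>The estimate is
  \<open>\<parallel>T z h - T y k\<parallel> \<le> \<parallel>T z h - T y h\<parallel> + \<parallel>T y h - T y k\<parallel> \<le> \<parallel>T z - T y\<parallel> \<parallel>h\<parallel> + \<parallel>h - k\<parallel>\<close>,
  where the last term uses that \<open>T y\<close> is an isometry.\<close>

lemma continuous_map_unitary_action: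
  assumes H: "inner_product_space H"
    and T: "continuous_map Z (mtopology_of (unitary_metric H)) T"
  shows "continuous_map (prod_topology Z (mtopology_of (vmetric H))) (mtopology_of (vmetric H))
    (\<lambda>(z, h). T z h)"
proof -
  interpret H: inner_product_space H by fact
  let ?m = "vmetric H"
  have TU: "T z \<in> unitaries H" if "z \<in> topspace Z" for z
    using continuous_map_funspace[OF T] that by (auto simp: H.mspace_unitary_metric)
  have "\<exists>N. openin (prod_topology Z (mtopology_of ?m)) N \<and> (z, h) \<in> N \<and>
      (\<forall>(y, k)\<in>N. mdist ?m (T z h) (T y k) < e)"
    if z: "z \<in> topspace Z" and h: "h \<in> vecs H" and e: "e > 0" for z h e
  proof -
    \<comment> \<open>The summand \<open>1\<close> avoids a division by zero at \<open>h = 0\<close>.\<close>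
    let ?d = "e / (2 * (vnorm H h + 1))"
    have nn: "0 \<le> vnorm H h" using h by (rule H.vnorm_nonneg)
    have d: "?d > 0" using e nn by simp
    then obtain N where N: "openin Z N" "z \<in> N"
      and close: "\<And>y. y \<in> N \<Longrightarrow> mdist (unitary_metric H) (T z) (T y) < ?d"
      using T z unfolding continuous_map_into_mtopology_of by meson
    have "mdist ?m (T z h) (T y k) < e" if y: "y \<in> N" and k: "k \<in> mball_of ?m h (e / 2)" for y k
    proof -
      have kH: "k \<in> vecs H" and hk: "mdist ?m h k < e / 2"
        using k by (auto simp: H.mspace_vmetric)
      have yZ: "y \<in> topspace Z" using N(1) y openin_subset by blast
      have uy: "unitary_map H H (T y)" using TU[OF yZ] by (simp add: unitaries_def)
      note cl = H.unitary_closed[OF TU[OF z]] H.unitary_closed[OF TU[OF yZ]]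
      have "mdist ?m (T z h) (T y h) \<le> op_dist H (T z) (T y) * vnorm H h"
        using H.op_dist_bound[OF TU[OF z] TU[OF yZ] h] h by (simp add: H.mdist_vmetric cl)
      also have "\<dots> \<le> ?d * vnorm H h"
        using close[OF y] nn by (intro mult_right_mono) (simp_all add: H.mdist_unitary_metric TU z yZ)
      also have "\<dots> \<le> e / 2" using e nn by (simp add: field_simps)
      finally have 1: "mdist ?m (T z h) (T y h) \<le> e / 2" .
      have "mdist ?m (T y h) (T y k) = mdist ?m h k"
        using unitary_map_diff[OF H uy h kH] unitary_mapD(5)[OF uy H.diff_closed[OF h kH]] h kH
        by (simp add: H.mdist_vmetric cl)
      with 1 hk show ?thesis
        using mdist_triangle[of "T z h" ?m "T y h" "T y k"] h kH by (simp add: H.mspace_vmetric cl)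
    qed
    then show ?thesis
      using N h e centre_in_mball_of[of h ?m "e / 2", unfolded H.mspace_vmetric] openin_mball_of[of ?m h "e / 2"]
      by (intro exI[of _ "N \<times> mball_of ?m h (e / 2)"])
        (auto simp: openin_prod_Times_iff H.mspace_vmetric simp del: in_mball_of)
  qed
  then have "\<forall>p\<in>topspace (prod_topology Z (mtopology_of ?m)). \<forall>e>0.
      \<exists>N. openin (prod_topology Z (mtopology_of ?m)) N \<and> p \<in> N \<and>
        (\<forall>q\<in>N. mdist ?m ((\<lambda>(z, h). T z h) p) ((\<lambda>(z, h). T z h) q) < e)"
    by (simp add: H.mspace_vmetric case_prod_unfold)
  moreover have "(\<lambda>(z, h). T z h) \<in> topspace (prod_topology Z (mtopology_of ?m)) \<rightarrow> mspace ?m"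
    by (auto simp: H.mspace_vmetric H.unitary_closed TU)
  ultimately show ?thesis unfolding continuous_map_into_mtopology_of by blast
qed

text \<open>As the bound \<open>L\<close> is uniform in \<open>z\<close>, all values lie in the stage \<open>L\<close> of the inductive limit, where
  the topology is that of the operator norm.\<close>

lemma continuous_map_end_topology:
  assumes H: "inner_product_space H"
    and T: "continuous_map Z (mtopology_of (unitary_metric H)) T"
    and propagation_le: "\<And>z. z \<in> topspace Z \<Longrightarrow> propagation H J b (T z) \<le> ereal L"
  shows "continuous_map Z (end_topology H J b) T"
proof -
  interpret H: inner_product_space H by fact
  let ?P = "unitaries_prop_le H J b L"
  let ?M = "mtopology_of (submetric (unitary_metric H) ?P)"
  have TP: "T z \<in> ?P" if "z \<in> topspace Z" for z
    using continuous_map_funspace[OF T] propagation_le that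
    by (auto simp: unitaries_prop_le_def H.mspace_unitary_metric)
  have TM: "continuous_map Z ?M T"
    unfolding mtopology_of_submetric using T TP by (intro continuous_map_into_subtopology) auto
  have "closedin Z {z \<in> topspace Z. T z \<in> C}" if "closedin (end_topology H J b) C" for C
  proof -
    have "closedin ?M (C \<inter> ?P)" using that by (simp add: H.closedin_end_topology)
    then have "closedin Z {z \<in> topspace Z. T z \<in> C \<inter> ?P}"
      by (rule closedin_continuous_map_preimage[OF TM])
    also have "{z \<in> topspace Z. T z \<in> C \<inter> ?P} = {z \<in> topspace Z. T z \<in> C}" using TP by auto
    finally show ?thesis .
  qed
  moreover have "T \<in> topspace Z \<rightarrow> topspace (end_topology H J b)"
  proof -
    have "openin (end_topology H J b) (end_unitaries H J b)"
      by (simp add: H.openin_end_topology)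
    then show ?thesis
      using TP openin_subset by (fastforce simp: end_unitaries_def)
  qed
  ultimately show ?thesis by (simp add: continuous_map_closedin)
qed

section \<open>The completed sum of simultaneously trivialized bundles\<close>

lemma inner_product_space_tagged:
  assumes "inner_product_space V"
  shows "inner_product_space (tagged_space x V)"
proof -
  interpret inner_product_space V by fact
  show ?thesis
    by unfold_locales
      (auto simp: tagged_space_def zero_closed add_closed scale_closed add_assoc add_zero add_neg
        scale_one scale_scale scale_add_right scale_add_left herm_add herm_scale
        intro: add_commute herm_sym herm_pos)
qed

lemma unitary_map_snd: "inner_product_space V \<Longrightarrow> unitary_map (tagged_space x V) V snd"
  by (rule unitary_mapI[OF inner_product_space_tagged]) (auto simp: tagged_space_def)

lemma sum_trivialization_flatten:
  "sum_trivialization I r f e = flatten I (\<lambda>i. {1..r i}) (\<lambda>i\<in>I. f i (snd e i))"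
  by (auto simp: sum_trivialization_def flatten_def fun_eq_iff restrict_def)

locale simultaneously_trivialized =
  fixes X :: "'x metric" and I :: "'i set"
    and E :: "'i \<Rightarrow> ('x, 'e) hermitian_family" and r :: "'i \<Rightarrow> nat"
    and \<Lambda> :: "'l set" and U :: "'l \<Rightarrow> 'x set"
    and \<phi> :: "'l \<Rightarrow> 'i \<Rightarrow> 'e \<Rightarrow> nat \<Rightarrow> complex"
  assumes family: "\<And>i. i \<in> I \<Longrightarrow> hermitian_family (mtopology_of X) (E i)"
    and cover_open: "\<And>l. l \<in> \<Lambda> \<Longrightarrow> openin (mtopology_of X) (U l)"
    and cover: "(\<Union>l\<in>\<Lambda>. U l) = mspace X"
    and trivial: "\<And>l i. l \<in> \<Lambda> \<Longrightarrow> i \<in> I \<Longrightarrow>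
          trivialization (mtopology_of X) (E i) (unitary_space (r i)) (U l) (\<phi> l i)"
    and equicontinuous: "\<And>l m. l \<in> \<Lambda> \<Longrightarrow> m \<in> \<Lambda> \<Longrightarrow>
          equicontinuous_family I (submetric X (U l \<inter> U m))
            (\<lambda>i. unitary_metric (unitary_space (r i)))
            (\<lambda>i. transition (E i) (unitary_space (r i)) (\<phi> l i) (\<phi> m i))"
begin

(* Otherwise the simplifier turns {1..r i} into {Suc 0..r i}, and facts no longer match. *)
declare One_nat_def [simp del]

abbreviation "fibre_sum x \<equiv> hilbert_sum I (\<lambda>i. fib (E i) x)"
abbreviation "model_sum \<equiv> hilbert_sum I (\<lambda>i. unitary_space (r i))"
abbreviation "model \<equiv> ell2 (SIGMA i:I. {1..r i})"
abbreviation "B \<equiv> completed_sum (mtopology_of X) I E r \<Lambda> U \<phi>"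
abbreviation "chart l \<equiv> sum_trivialization I r (\<phi> l)"
abbreviation "block_transition i l m \<equiv> transition (E i) (unitary_space (r i)) (\<phi> l i) (\<phi> m i)"
abbreviation "sum_transition l m \<equiv> transition B model (chart l) (chart m)"

lemma cover_subset: "l \<in> \<Lambda> \<Longrightarrow> x \<in> U l \<Longrightarrow> x \<in> mspace X"
  using cover by blast

lemma fib_B: "fib B x = tagged_space x (fibre_sum x)"
  by (simp add: completed_sum_def)

lemma pr_B: "pr B = fst"
  by (simp add: completed_sum_def)

lemma vecs_fib_B: "vecs (fib B x) = {x} \<times> vecs (fibre_sum x)"
  by (simp add: fib_B tagged_space_def)

lemma inner_product_space_fibres:
  assumes "x \<in> mspace X"
  shows "i \<in> I \<Longrightarrow> inner_product_space (fib (E i) x)" "inner_product_space (fibre_sum x)"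
    "inner_product_space (fib B x)"
proof -
  show 1: "inner_product_space (fib (E i) x)" if "i \<in> I" for i
    using family[OF that] assms by (simp add: hermitian_family_def)
  then show 2: "inner_product_space (fibre_sum x)" by (rule inner_product_space_hilbert_sum)
  then show "inner_product_space (fib B x)" unfolding fib_B by (rule inner_product_space_tagged)
qed

lemma trivial_unitary:
  "l \<in> \<Lambda> \<Longrightarrow> x \<in> U l \<Longrightarrow> i \<in> I \<Longrightarrow> unitary_map (fib (E i) x) (unitary_space (r i)) (\<phi> l i)"
  using trivial by (auto simp: trivialization_def)

lemma unitary_map_trivial_sum:
  assumes "l \<in> \<Lambda>" "x \<in> U l"
  shows "unitary_map (fibre_sum x) model_sum (\<lambda>v. \<lambda>i\<in>I. \<phi> l i (v i))"
  using inner_product_space_fibres(1)[OF cover_subset[OF assms]] trivial_unitary[OF assms]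
  by (intro unitary_map_direct_sum inner_product_space_ell2)

lemma chart_unitary:
  assumes l: "l \<in> \<Lambda>" "x \<in> U l"
  shows "unitary_map (fib B x) model (chart l)"
proof -
  have "unitary_map (fibre_sum x) model (\<lambda>v. flatten I (\<lambda>i. {1..r i}) (\<lambda>i\<in>I. \<phi> l i (v i)))"
    by (rule unitary_map_comp[OF unitary_map_trivial_sum[OF l] unitary_map_flatten])
  then show ?thesis
    unfolding fib_B sum_trivialization_flatten
    by (rule unitary_map_comp[OF unitary_map_snd[OF inner_product_space_fibres(2)
        [OF cover_subset[OF l]]]])
qed

lemma block_transition_unitary:
  assumes "l \<in> \<Lambda>" "m \<in> \<Lambda>" "x \<in> U l \<inter> U m" "i \<in> I"
  shows "block_transition i l m x \<in> unitaries (unitary_space (r i))"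
  using assms inner_product_space_fibres(1) cover_subset
  by (intro transition_unitary trivial_unitary inner_product_space_ell2) auto

lemma sum_transition_unitary:
  assumes "l \<in> \<Lambda>" "m \<in> \<Lambda>" "x \<in> U l \<inter> U m"
  shows "sum_transition l m x \<in> unitaries model"
  using assms inner_product_space_fibres(3) cover_subset
  by (intro transition_unitary chart_unitary inner_product_space_ell2) auto

text \<open>Each vector of the model is the image of some \<open>v\<close> in the fibre under the second chart, and
  both sides send it to the image of \<open>v\<close> under the first chart.\<close>

lemma sum_transition_block:
  assumes lm: "l \<in> \<Lambda>" "m \<in> \<Lambda>" "x \<in> U l \<inter> U m" and s: "s \<in> vecs model_sum"
  shows "sum_transition l m x (flatten I (\<lambda>i. {1..r i}) s)
    = flatten I (\<lambda>i. {1..r i}) (\<lambda>i\<in>I. block_transition i l m x (s i))"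
proof -
  have x: "x \<in> U l" "x \<in> U m" "x \<in> mspace X" using lm cover_subset by auto
  note um = unitary_map_trivial_sum[OF lm(2) x(2)]
  define v where "v = inv_into (vecs (fibre_sum x)) (\<lambda>v. \<lambda>i\<in>I. \<phi> m i (v i)) s"
  have v: "v \<in> vecs (fibre_sum x)" and vs: "(\<lambda>i\<in>I. \<phi> m i (v i)) = s"
    using unitary_mapD(7,8)[OF um s] by (simp_all add: v_def)
  have vi: "v i \<in> vecs (fib (E i) x)" if "i \<in> I" for i
    using hilbert_sum_memD(1)[OF inner_product_space_fibres(1)[OF x(3)] v that] .
  have "sum_transition l m x (chart m (x, v)) = chart l (x, v)"
    using chart_unitary[OF lm(2) x(2)] v by (intro transition_apply) (auto simp: vecs_fib_B)
  moreover have "block_transition i l m x (s i) = \<phi> l i (v i)" if i: "i \<in> I" for i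
    using transition_apply[OF trivial_unitary[OF lm(2) x(2) i] vi[OF i]] fun_cong[OF vs, of i] i
    by simp
  ultimately show ?thesis
    by (simp add: sum_trivialization_flatten vs cong: restrict_cong)
qed

text \<open>The blocks are controlled by a \<open>d\<close> that does not depend on \<open>i\<close>, which is where
  equicontinuity enters. Their distances are below \<open>e / 2\<close>, and the supremum of them is still
  strictly below \<open>e\<close>.\<close>

lemma continuous_map_sum_transition:
  assumes lm: "l \<in> \<Lambda>" "m \<in> \<Lambda>"
  shows "continuous_map (subtopology (mtopology_of X) (U l \<inter> U m))
    (mtopology_of (unitary_metric model)) (sum_transition l m)"
proof -
  interpret H: inner_product_space model by (rule inner_product_space_ell2)
  let ?Y = "submetric X (U l \<inter> U m)"
  have "\<exists>N. openin (mtopology_of ?Y) N \<and> x \<in> N \<and>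
      (\<forall>y\<in>N. mdist (unitary_metric model) (sum_transition l m x) (sum_transition l m y) < e)"
    if x: "x \<in> mspace ?Y" and e: "e > 0" for x e
  proof -
    obtain d where d: "d > 0" and close: "\<And>i y. \<lbrakk>i \<in> I; y \<in> mspace ?Y; mdist ?Y x y < d\<rbrakk> \<Longrightarrow>
        mdist (unitary_metric (unitary_space (r i))) (block_transition i l m x) (block_transition i l m y) < e / 2"
      using equicontinuous[OF lm] x e unfolding equicontinuous_family_def
      by (metis half_gt_zero)
    have "mdist (unitary_metric model) (sum_transition l m x) (sum_transition l m y) < e"
      if y: "y \<in> mball_of ?Y x d" for y
    proof -
      have xy: "x \<in> U l \<inter> U m" "y \<in> U l \<inter> U m" "y \<in> mspace ?Y" "mdist ?Y x y < d"
        using x y by auto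
      have "op_dist model (sum_transition l m x) (sum_transition l m y) \<le> e / 2"
      proof (rule op_dist_direct_sum_le[OF inner_product_space_ell2 _ unitary_map_flatten])
        show "inner_product_space model" by (rule inner_product_space_ell2)
        show "op_dist (unitary_space (r i)) (block_transition i l m x) (block_transition i l m y) \<le> e / 2"
          if i: "i \<in> I" for i
          using close[OF i xy(3,4)] block_transition_unitary[OF lm xy(1) i] block_transition_unitary[OF lm xy(2) i]
          by (simp add: inner_product_space.mdist_unitary_metric[OF inner_product_space_ell2])
      qed (use e lm xy in \<open>auto intro: block_transition_unitary sum_transition_block\<close>)
      also have "e / 2 < e" using e by simp
      finally show ?thesis
        using sum_transition_unitary[OF lm xy(1)] sum_transition_unitary[OF lm xy(2)]
        by (simp add: H.mdist_unitary_metric)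
    qed
    then show ?thesis
      using centre_in_mball_of[OF x d] openin_mball_of[of ?Y x d] by blast
  qed
  moreover have "sum_transition l m \<in> mspace ?Y \<rightarrow> mspace (unitary_metric model)"
    using lm by (auto simp: H.mspace_unitary_metric intro: sum_transition_unitary)
  ultimately show ?thesis
    unfolding mtopology_of_submetric[symmetric] continuous_map_into_mtopology_of by simp
qed

definition chart_preimage :: "'l \<Rightarrow> ('x \<times> ('i \<times> nat \<Rightarrow> complex)) set \<Rightarrow> ('x \<times> ('i \<Rightarrow> 'e)) set" where
  "chart_preimage l W = {(x, v). x \<in> U l \<and> v \<in> vecs (fibre_sum x) \<and> (x, chart l (x, v)) \<in> W}"

abbreviation "product_space \<equiv> prod_topology (mtopology_of X) (mtopology_of (vmetric model))"

lemma tot_B: "tot B = topology_generated_by {chart_preimage l W | l W. l \<in> \<Lambda> \<and> openin product_space W}"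
  by (simp add: completed_sum_def chart_preimage_def)

lemma openin_chart_preimage: "l \<in> \<Lambda> \<Longrightarrow> openin product_space W \<Longrightarrow> openin (tot B) (chart_preimage l W)"
  unfolding tot_B by (rule topology_generated_by_Basis) blast

lemma chart_closed:
  "l \<in> \<Lambda> \<Longrightarrow> x \<in> U l \<Longrightarrow> v \<in> vecs (fibre_sum x) \<Longrightarrow> chart l (x, v) \<in> vecs model"
  using unitary_mapD(1)[OF chart_unitary] by (simp add: vecs_fib_B)

lemma topspace_product: "topspace product_space = mspace X \<times> vecs model"
  by (simp add: inner_product_space.mspace_vmetric[OF inner_product_space_ell2])

lemma topspace_B: "topspace (tot B) = (SIGMA x:mspace X. vecs (fibre_sum x))"
proof
  show "topspace (tot B) \<subseteq> (SIGMA x:mspace X. vecs (fibre_sum x))"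
    unfolding tot_B topology_generated_by_topspace by (auto simp: chart_preimage_def cover_subset)
  have "(x, v) \<in> topspace (tot B)" if x: "x \<in> mspace X" and v: "v \<in> vecs (fibre_sum x)" for x v
  proof -
    obtain l where l: "l \<in> \<Lambda>" "x \<in> U l" using cover x by blast
    have "(x, v) \<in> chart_preimage l (topspace product_space)"
      unfolding topspace_product using l v x by (simp add: chart_preimage_def chart_closed)
    then show ?thesis
      using openin_subset[OF openin_chart_preimage[OF l(1) openin_topspace]] by blast
  qed
  then show "(SIGMA x:mspace X. vecs (fibre_sum x)) \<subseteq> topspace (tot B)" by blast
qed

lemma hermitian_family_B: "hermitian_family (mtopology_of X) B"
  unfolding hermitian_family_def
proof (intro conjI ballI)
  show "continuous_map (tot B) (mtopology_of X) (pr B)"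
    unfolding continuous_map_def
  proof (intro conjI allI impI)
    show "pr B \<in> topspace (tot B) \<rightarrow> topspace (mtopology_of X)"
      by (auto simp: pr_B topspace_B)
    fix V assume V: "openin (mtopology_of X) V"
    then have VX: "V \<subseteq> mspace X" using openin_subset by fastforce
    have "{e \<in> topspace (tot B). pr B e \<in> V} = (\<Union>l\<in>\<Lambda>. chart_preimage l (V \<times> vecs model))"
      using VX cover cover_subset
      by (fastforce simp: topspace_B pr_B chart_preimage_def chart_closed)
    moreover have "openin product_space (V \<times> vecs model)"
      using V openin_topspace[of "mtopology_of (vmetric model)"]
      by (simp add: openin_prod_Times_iff inner_product_space.mspace_vmetric[OF inner_product_space_ell2])
    ultimately show "openin (tot B) {e \<in> topspace (tot B). pr B e \<in> V}"
      using openin_chart_preimage by auto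
  qed
  fix x assume "x \<in> topspace (mtopology_of X)"
  then have x: "x \<in> mspace X" by simp
  show "inner_product_space (fib B x)" using x by (rule inner_product_space_fibres)
  show "vecs (fib B x) = {e \<in> topspace (tot B). pr B e = x}"
    using x by (auto simp: vecs_fib_B topspace_B pr_B)
qed

text \<open>Continuity of the inverse chart is tested on the generating open sets, which come from all
  charts \<open>m\<close>: followed by the chart \<open>m\<close>, the inverse of the chart \<open>l\<close> is the change of charts, so
  that a generating set pulls back to the preimage of an open set under a continuous map defined
  on the open set over \<open>U m \<inter> U l\<close>.\<close>

lemma trivialization_B:
  assumes l: "l \<in> \<Lambda>"
  shows "trivialization (mtopology_of X) B model (U l) (chart l)"
  unfolding trivialization_def
proof (intro conjI ballI)
  show "unitary_map (fib B x) model (chart l)" if "x \<in> U l" for x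
    using l that by (rule chart_unitary)
  let ?D = "subtopology (tot B) {e. pr B e \<in> U l}"
  let ?H = "mtopology_of (vmetric model)"
  let ?P = "prod_topology (subtopology (mtopology_of X) (U l)) ?H"
  let ?f = "\<lambda>e. (pr B e, chart l e)" and ?g = "\<lambda>(x, h). inv_into (vecs (fib B x)) (chart l) h"
  have tH: "mspace (vmetric model) = vecs model" "topspace ?H = vecs model"
    by (simp_all add: inner_product_space.mspace_vmetric[OF inner_product_space_ell2])
  have tP: "topspace ?P = U l \<times> vecs model"
    using l cover_subset by (auto simp: inner_product_space.mspace_vmetric[OF inner_product_space_ell2])
  have tD: "topspace ?D = (SIGMA x:U l. vecs (fibre_sum x))"
    using l cover_subset by (auto simp: topspace_B pr_B)
  have P_sub: "?P = subtopology product_space (U l \<times> vecs model)"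
    using tH by (simp add: prod_topology_subtopology)
  have Ul: "openin product_space (U l \<times> vecs model)"
    using cover_open[OF l] openin_topspace[of ?H] by (simp add: tH openin_prod_Times_iff)
  have f: "?f e \<in> topspace ?P" if "e \<in> topspace ?D" for e
    using that l unfolding tP tD by (auto simp: pr_B chart_closed)
  have g: "?g p \<in> topspace ?D" "?f (?g p) = p" "fst (?g p) = fst p" if "p \<in> topspace ?P" for p
  proof -
    obtain x h where p: "p = (x, h)" "x \<in> U l" "h \<in> vecs model" using \<open>p \<in> topspace ?P\<close> tP by auto
    note D = unitary_mapD(7,8)[OF chart_unitary[OF l p(2)] p(3)]
    show "?g p \<in> topspace ?D" "?f (?g p) = p" "fst (?g p) = fst p"
      using D p unfolding tD by (auto simp: vecs_fib_B pr_B)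
  qed
  have "homeomorphic_maps ?D ?P ?f ?g"
    unfolding homeomorphic_maps_def
  proof (intro conjI ballI)
    show "continuous_map ?D ?P ?f"
      unfolding continuous_map_def
    proof (intro conjI allI impI)
      show "?f \<in> topspace ?D \<rightarrow> topspace ?P" using f by blast
      fix W assume W: "openin ?P W"
      then have Wo: "openin product_space W"
        using Ul P_sub openin_open_subtopology by metis
      have "{e \<in> topspace ?D. ?f e \<in> W} = {e. pr B e \<in> U l} \<inter> chart_preimage l W"
        unfolding tD by (auto simp: chart_preimage_def pr_B)
      then show "openin ?D {e \<in> topspace ?D. ?f e \<in> W}"
        using openin_subtopology_Int2[OF openin_chart_preimage[OF l Wo]] by simp
    qed
    show "continuous_map ?P ?D ?g"
    proof (rule continuous_map_into_subtopology)
      show "?g \<in> topspace ?P \<rightarrow> {e. pr B e \<in> U l}"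
        using g(3) tP by (force simp: pr_B)
      show "continuous_map ?P (tot B) ?g"
        unfolding tot_B
      proof (rule continuous_on_generated_topo)
        show "?g ` topspace ?P \<subseteq> \<Union>{chart_preimage m W | m W. m \<in> \<Lambda> \<and> openin product_space W}"
          using g(1) unfolding topology_generated_by_topspace[symmetric] tot_B[symmetric] by auto
        fix V assume "V \<in> {chart_preimage m W | m W. m \<in> \<Lambda> \<and> openin product_space W}"
        then obtain m W where V: "V = chart_preimage m W" and m: "m \<in> \<Lambda>"
          and W: "openin product_space W" by blast
        let ?O = "U m \<inter> U l"
        let ?Q = "prod_topology (subtopology (mtopology_of X) ?O) ?H"
        let ?t = "\<lambda>(x, h). (x, sum_transition m l x h)"
        have tQ: "topspace ?Q = ?O \<times> vecs model"
          using l cover_subset by (auto simp: inner_product_space.mspace_vmetric[OF inner_product_space_ell2])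
        have Q_sub: "?Q = subtopology product_space (?O \<times> vecs model)"
          using tH by (simp add: prod_topology_subtopology)
        have "continuous_map ?Q ?H (\<lambda>(x, h). sum_transition m l x h)"
          by (rule continuous_map_unitary_action[OF inner_product_space_ell2 continuous_map_sum_transition[OF m l]])
        then have "continuous_map ?Q product_space ?t"
          using continuous_map_into_fulltopology[OF continuous_map_fst, of "mtopology_of X" ?O ?H]
          by (simp add: continuous_map_pairwise comp_def case_prod_unfold)
        then have "openin ?Q {p \<in> topspace ?Q. ?t p \<in> W}"
          using W by (rule openin_continuous_map_preimage)
        then have "openin (subtopology product_space (?O \<times> vecs model)) {p \<in> topspace ?Q. ?t p \<in> W}"
          unfolding Q_sub .
        moreover have "openin product_space (?O \<times> vecs model)"
          using cover_open[OF l] cover_open[OF m] openin_topspace[of ?H]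
          by (simp add: tH openin_prod_Times_iff openin_Int)
        ultimately have "openin product_space {p \<in> topspace ?Q. ?t p \<in> W}"
          by (rule openin_trans_full)
        then have "openin ?P {p \<in> topspace ?Q. ?t p \<in> W}"
          unfolding P_sub openin_open_subtopology[OF Ul] tQ by auto
        moreover have "?g -` V \<inter> topspace ?P = {p \<in> topspace ?Q. ?t p \<in> W}"
        proof -
          have eq: "?g (x, h) \<in> V \<longleftrightarrow> x \<in> U m \<and> (x, sum_transition m l x h) \<in> W"
            if xh: "x \<in> U l" "h \<in> vecs model" for x h
          proof -
            have "?g (x, h) \<in> {x} \<times> vecs (fibre_sum x)"
              using unitary_mapD(7)[OF chart_unitary[OF l xh(1)] xh(2)] by (simp add: vecs_fib_B)
            then obtain v where v: "?g (x, h) = (x, v)" "v \<in> vecs (fibre_sum x)" by auto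
            then have "sum_transition m l x h = chart m (x, v)"
              using xh by (simp add: transition_def)
            then show ?thesis using v by (simp add: V chart_preimage_def)
          qed
          show ?thesis
          proof (rule set_eqI)
            fix p :: "'x \<times> ('i \<times> nat \<Rightarrow> complex)"
            obtain x h where "p = (x, h)" by fastforce
            then show "p \<in> ?g -` V \<inter> topspace ?P \<longleftrightarrow> p \<in> {p \<in> topspace ?Q. ?t p \<in> W}"
              unfolding tP tQ using eq[of x h]
              by (cases "x \<in> U l \<and> h \<in> vecs model") auto
          qed
        qed
        ultimately show "openin ?P (?g -` V \<inter> topspace ?P)" by simp
      qed
    qed
    show "?g (?f e) = e" if "e \<in> topspace ?D" for e
      using that unfolding tD
      using unitary_mapD(6)[OF chart_unitary[OF l]] by (auto simp: pr_B vecs_fib_B)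
    show "?f (?g p) = p" if "p \<in> topspace ?P" for p using g(2) that .
  qed
  then show "homeomorphic_map ?D ?P ?f" by (rule homeomorphic_maps_imp_map)
qed

lemma hilbert_bundle_B: "hilbert_bundle (mtopology_of X) B model \<Lambda> U chart"
  unfolding hilbert_bundle_def
  using hilbert_space_ell2 hermitian_family_B cover_open cover trivialization_B continuous_map_sum_transition
  by simp

end

theorem theorem4p3:
  fixes X :: "'x metric" and I :: "'i metric"
    and E :: "'i \<Rightarrow> ('x, 'e) hermitian_family" and r :: "'i \<Rightarrow> nat"
    and \<Lambda> :: "'l set" and U :: "'l \<Rightarrow> 'x set"
    and \<phi> :: "'l \<Rightarrow> 'i \<Rightarrow> 'e \<Rightarrow> nat \<Rightarrow> complex"
  assumes bundles: "\<And>i. i \<in> mspace I \<Longrightarrow> hermitian_vector_bundle (mtopology_of X) (r i) (E i)"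
    and cover_open: "\<And>l. l \<in> \<Lambda> \<Longrightarrow> openin (mtopology_of X) (U l)"
    and cover: "(\<Union>l\<in>\<Lambda>. U l) = mspace X"
    and trivial: "\<And>l i. l \<in> \<Lambda> \<Longrightarrow> i \<in> mspace I \<Longrightarrow>
          trivialization (mtopology_of X) (E i) (unitary_space (r i)) (U l) (\<phi> l i)"
    and equicontinuous: "\<And>l m. l \<in> \<Lambda> \<Longrightarrow> m \<in> \<Lambda> \<Longrightarrow>
          equicontinuous_family (mspace I) (submetric X (U l \<inter> U m))
            (\<lambda>i. unitary_metric (unitary_space (r i)))
            (\<lambda>i. transition (E i) (unitary_space (r i)) (\<phi> l i) (\<phi> m i))"
    and countable: "countable (mspace I)"
    and bounded_rank: "bdd_above (r ` mspace I)"
  shows "hilbert_bundle_with_end (mtopology_of X)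
           (completed_sum (mtopology_of X) (mspace I) E r \<Lambda> U \<phi>)
           (ell2 (mspace (pair_metric I r))) (pair_metric I r) (std_basis (mspace (pair_metric I r)))
           \<Lambda> U (\<lambda>l. sum_trivialization (mspace I) r (\<phi> l))"
proof -
  interpret simultaneously_trivialized X "mspace I" E r \<Lambda> U \<phi>
    using bundles cover_open cover trivial equicontinuous
    by unfold_locales (auto simp: hermitian_vector_bundle_def)
  have "continuous_map (subtopology (mtopology_of X) (U l \<inter> U m))
      (end_topology model (pair_metric I r) (std_basis (mspace (pair_metric I r)))) (sum_transition l m)"
    if lm: "l \<in> \<Lambda>" "m \<in> \<Lambda>" for l m
  proof (rule continuous_map_end_topology[OF inner_product_space_ell2 continuous_map_sum_transition[OF lm]])
    fix x assume "x \<in> topspace (subtopology (mtopology_of X) (U l \<inter> U m))"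
    then have x: "x \<in> U l \<inter> U m" by simp
    show "propagation model (pair_metric I r) (std_basis (mspace (pair_metric I r))) (sum_transition l m x)
        \<le> ereal 1"
      using block_operator_propagation[where I = I and r = r and t = "\<lambda>i. block_transition i l m x" and T = "sum_transition l m x"]
        block_transition_unitary[OF lm x] sum_transition_block[OF lm x]
      by (simp add: mspace_pair_metric)
  qed
  moreover have "countable (mspace (pair_metric I r))"
    using countable by (simp add: mspace_pair_metric)
  moreover have "hilbert_bundle (mtopology_of X) B (ell2 (mspace (pair_metric I r))) \<Lambda> U chart"
    using hilbert_bundle_B by (simp add: mspace_pair_metric)
  ultimately show ?thesis
    using orthonormal_basis_std_basis[of "mspace (pair_metric I r)"]
    unfolding hilbert_bundle_with_end_def by (simp add: mspace_pair_metric)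
qed

end
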